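(* Let $M$ be a connected hypersurface of ${\rm Sol}_0^4$ with constant principal curvatures and constant angle functions $c$ and $d$. Then, up to isometries of ${\rm Sol}_0^4$, one of the following four cases occurs: (1) $M$ is an open part of $$M_{1,r}=\{(e^{x_3}\cos x_1\tanh r,\ e^{x_3}\sin x_1\tanh r,\ x_2,\ x_3+\ln(\operatorname{sech} r))\in{\rm Sol}_0^4\mid x_1,x_2,x_3\in\mathbb{R}\}$$ for some $r>0$, and has principal curvatures $\coth r$, $\tanh r$ and $-2\tanh r$; (2) $M$ is an open part of $$M_{2,r}=\{(x_1,\ e^{x_3}\tanh r,\ x_2,\ x_3+\ln(\operatorname{sech} r))\in{\rm Sol}_0^4\mid x_1,x_2,x_3\in\mathbb{R}\}$$ for some $r\ge 0$, and has principal curvatures $\tanh r$ (multiplicity 2) and $-2\tanh r$; (3) $M$ is an open part of $$M_{3,r}=\{(x_1,\ x_2,\ \tfrac12 e^{-2x_3}\tanh(2r),\ x_3+\tfrac12\ln(\cosh(2r)))\in{\rm Sol}_0^4\mid x_1,x_2,x_3\in\mathbb{R}\}$$ for some $r\ge 0$, and has principal curvatures $\tanh(2r)$ (multiplicity 2) and $-2\tanh(2r)$; (4) $M$ is an open part of $$M_{4,0}=\{(x,y,z,0)\in{\rm Sol}_0^4\mid x,y,z\in\mathbb{R}\},$$ and has principal curvatures $1$ (multiplicity 2) and $-2$.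
   Context: ${\rm Sol}_0^4$ is the Lie group $\mathbb{R}^4=\{(x,y,z,t)\}$ with product $(\tilde x,\tilde y,\tilde z,\tilde t)\cdot(x,y,z,t)=(\tilde x+e^{\tilde t}x,\tilde y+e^{\tilde t}y,\tilde z+e^{-2\tilde t}z,\tilde t+t)$, equipped with the left invariant Riemannian metric $g=e^{-2t}(dx^2+dy^2)+e^{4t}dz^2+dt^2$. The left invariant vector fields $E_1=e^t\partial_x$, $E_2=e^t\partial_y$, $E_3=e^{-2t}\partial_z$, $E_4=\partial_t$ form a $g$-orthonormal frame. Isometries of ${\rm Sol}_0^4$: the group ${\rm Sol}_0^4\rtimes({\rm O}(2)\times\mathbb{Z}_2)$, where ${\rm Sol}_0^4$ acts by left translations, ${\rm O}(2)$ acts linearly on the $xy$-plane, and $\mathbb{Z}_2$ acts by the reflection $z\mapsto -z$. Hypersurface: an isometrically immersed hypersurface $M$ with a globally defined unit normal vector field $N$. Its angle functions are the smooth functions $a=g(N,E_1)$, $b=g(N,E_2)$, $c=g(N,E_3)$, $d=g(N,E_4)$ on $M$, so $a^2+b^2+c^2+d^2=1$. The shape operator is $AX=-\tilde\nabla_XN$, with $\tilde\nabla$ the Levi-Civita connection of $g$; principal curvatures are the eigenvalues of $A$ (listed in the theorem for a suitable choice of sign of $N$), and they are constant if the eigenvalues counted with multiplicity do not depend on the point. "Up to isometries" means after applying an isometry of ${\rm Sol}_0^4$ to $M$. *)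

theory Defs
  imports "HOL-Analysis.Analysis"
begin

section \<open>Smooth maps and smooth manifolds\<close>

fun times_differentiable_on ::
  "nat \<Rightarrow> ('a::real_normed_vector \<Rightarrow> 'b::real_normed_vector) \<Rightarrow> 'a set \<Rightarrow> bool" where
  "times_differentiable_on 0 F S \<longleftrightarrow> continuous_on S F"
| "times_differentiable_on (Suc n) F S \<longleftrightarrow>
     (\<forall>x\<in>S. F differentiable (at x)) \<and>
     (\<forall>v. times_differentiable_on n (\<lambda>x. frechet_derivative F (at x) v) S)"

text \<open>Class \<open>C\<^sup>\<infinity>\<close>; used only for open sets \<open>S\<close>, where it does not depend on the
  values of \<open>F\<close> outside \<open>S\<close>.\<close>

definition smooth_map_on ::
  "('a::real_normed_vector \<Rightarrow> 'b::real_normed_vector) \<Rightarrow> 'a set \<Rightarrow> bool" where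
  "smooth_map_on F S \<longleftrightarrow> (\<forall>n. times_differentiable_on n F S)"

text \<open>An atlas is given by local parametrizations, i.e. inverses of charts: a pair
  \<open>(V, \<phi>)\<close> consists of an open subset \<open>V\<close> of the model space and a homeomorphism \<open>\<phi>\<close> from \<open>V\<close>
  onto an open subset of the manifold.\<close>

type_synonym ('e, 'm) atlas = "('e set \<times> ('e \<Rightarrow> 'm)) set"

definition smooth_manifold :: "'m topology \<Rightarrow> ('e::euclidean_space, 'm) atlas \<Rightarrow> bool" where
  "smooth_manifold M \<A> \<longleftrightarrow>
     Hausdorff_space M \<and> second_countable M \<and>
     (\<forall>(V, \<phi>)\<in>\<A>. open V \<and> openin M (\<phi> ` V) \<and> embedding_map (top_of_set V) M \<phi>) \<and>
     (\<Union>(V, \<phi>)\<in>\<A>. \<phi> ` V) = topspace M \<and>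
     (\<forall>(V, \<phi>)\<in>\<A>. \<forall>(W, \<psi>)\<in>\<A>.
        smooth_map_on (inv_into W \<psi> \<circ> \<phi>) {u \<in> V. \<phi> u \<in> \<psi> ` W})"


section \<open>The Riemannian Lie group \<open>Sol\<^sub>0\<^sup>4\<close>\<close>

text \<open>Points and (coordinate) tangent vectors are both elements of \<open>real ^ 4\<close>, with
  coordinates \<open>(x, y, z, t)\<close>.\<close>

definition sol_mult :: "real ^ 4 \<Rightarrow> real ^ 4 \<Rightarrow> real ^ 4" where
  "sol_mult q p = vector
     [q$1 + exp (q$4) * p$1, q$2 + exp (q$4) * p$2, q$3 + exp (- 2 * q$4) * p$3, q$4 + p$4]"

definition sol_metric :: "real ^ 4 \<Rightarrow> real ^ 4 \<Rightarrow> real ^ 4 \<Rightarrow> real" where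
  "sol_metric p u v =
     exp (- 2 * p$4) * (u$1 * v$1 + u$2 * v$2) + exp (4 * p$4) * (u$3 * v$3) + u$4 * v$4"

definition sol_E1 :: "real ^ 4 \<Rightarrow> real ^ 4" where "sol_E1 p = vector [exp (p$4), 0, 0, 0]"
definition sol_E2 :: "real ^ 4 \<Rightarrow> real ^ 4" where "sol_E2 p = vector [0, exp (p$4), 0, 0]"
definition sol_E3 :: "real ^ 4 \<Rightarrow> real ^ 4" where "sol_E3 p = vector [0, 0, exp (- 2 * p$4), 0]"
definition sol_E4 :: "real ^ 4 \<Rightarrow> real ^ 4" where "sol_E4 p = vector [0, 0, 0, 1]"

text \<open>The group \<open>Sol\<^sub>0\<^sup>4 \<rtimes> (O(2) \<times> \<int>\<^sub>2)\<close> of all isometries: a left translation after an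
  orthogonal map \<open>Q\<close> of the \<open>xy\<close>-plane and \<open>z \<mapsto> \<sigma> z\<close>, \<open>\<sigma> = \<plusminus>1\<close>.\<close>

definition sol_isometries :: "(real ^ 4 \<Rightarrow> real ^ 4) set" where
  "sol_isometries =
     {\<Phi>. \<exists>q. \<exists>Q :: real ^ 2 ^ 2. \<exists>\<sigma>\<in>{1, - 1}. orthogonal_matrix Q \<and>
        \<Phi> = (\<lambda>p. sol_mult q
               (vector [(Q *v vector [p$1, p$2])$1, (Q *v vector [p$1, p$2])$2, \<sigma> * p$3, p$4]))}"

text \<open>The Christoffel map of the Levi-Civita connection in the global coordinates, i.e. the
  covariant derivative of the constant vector field \<open>v\<close> in direction \<open>u\<close>, given by the Koszul
  formula for constant vector fields (whose Lie brackets vanish).\<close>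

definition sol_christoffel :: "real ^ 4 \<Rightarrow> real ^ 4 \<Rightarrow> real ^ 4 \<Rightarrow> real ^ 4" where
  "sol_christoffel p u v = (THE w. \<forall>e. sol_metric p w e =
     (frechet_derivative (\<lambda>q. sol_metric q v e) (at p) u
      + frechet_derivative (\<lambda>q. sol_metric q u e) (at p) v
      - frechet_derivative (\<lambda>q. sol_metric q u v) (at p) e) / 2)"

lemma vector_4 [simp]:
  "(vector [x, y, z, t] :: 'a::zero ^ 4) $ 1 = x"
  "(vector [x, y, z, t] :: 'a::zero ^ 4) $ 2 = y"
  "(vector [x, y, z, t] :: 'a::zero ^ 4) $ 3 = z"
  "(vector [x, y, z, t] :: 'a::zero ^ 4) $ 4 = t"
  by (simp_all add: vector_def)

lemma frechet_derivative_sol_metric: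
  "frechet_derivative (\<lambda>q. sol_metric q v w) (at p) u =
     u$4 * (- 2 * exp (- 2 * p$4) * (v$1 * w$1 + v$2 * w$2) + 4 * exp (4 * p$4) * (v$3 * w$3))"
proof -
  have "((\<lambda>q. sol_metric q v w) has_derivative (\<lambda>u. u$4 *
     (- 2 * exp (- 2 * p$4) * (v$1 * w$1 + v$2 * w$2) + 4 * exp (4 * p$4) * (v$3 * w$3)))) (at p)"
    unfolding sol_metric_def
    by (auto intro!: derivative_eq_intros bounded_linear_imp_has_derivative
          bounded_linear_vec_nth simp: algebra_simps fun_eq_iff)
  from frechet_derivative_at[OF this] show ?thesis by metis
qed

lemma sol_metric_eqI:
  assumes "\<And>e. sol_metric p w e = sol_metric p w' e"
  shows "w = w'"
proof -
  have "sol_metric p (w - w') (w - w') = 0"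
    using assms[of "w - w'"] by (simp add: sol_metric_def algebra_simps)
  moreover have "sol_metric p d d = exp (- 2 * p$4) * ((d$1)\<^sup>2 + (d$2)\<^sup>2)
      + exp (4 * p$4) * (d$3)\<^sup>2 + (d$4)\<^sup>2" for d
    by (simp add: sol_metric_def power2_eq_square)
  ultimately have "exp (- 2 * p$4) * (((w - w')$1)\<^sup>2 + ((w - w')$2)\<^sup>2) = 0 \<and>
      exp (4 * p$4) * ((w - w')$3)\<^sup>2 = 0 \<and> ((w - w')$4)\<^sup>2 = 0"
    by (smt (verit) exp_ge_zero mult_nonneg_nonneg zero_le_power2)
  then have "(w - w')$i = 0" for i
    using exhaust_4[of i] by (auto simp: sum_power2_eq_zero_iff)
  then show ?thesis by (simp add: vec_eq_iff)
qed

lemma sol_christoffel_eq: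
  "sol_christoffel p u v = vector
     [- (u$4 * v$1 + u$1 * v$4), - (u$4 * v$2 + u$2 * v$4), 2 * (u$4 * v$3 + u$3 * v$4),
      exp (- 2 * p$4) * (u$1 * v$1 + u$2 * v$2) - 2 * exp (4 * p$4) * (u$3 * v$3)]"
  (is "_ = ?G")
  unfolding sol_christoffel_def
proof (rule the_equality)
  show "\<forall>e. sol_metric p ?G e =
     (frechet_derivative (\<lambda>q. sol_metric q v e) (at p) u
      + frechet_derivative (\<lambda>q. sol_metric q u e) (at p) v
      - frechet_derivative (\<lambda>q. sol_metric q u v) (at p) e) / 2" (is "\<forall>e. _ = ?K e")
    unfolding frechet_derivative_sol_metric by (simp add: sol_metric_def field_simps)
  then show "w = ?G" if "\<forall>e. sol_metric p w e = ?K e" for w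
    using that by (metis (no_types, lifting) sol_metric_eqI)
qed


section \<open>Hypersurfaces\<close>

text \<open>An immersed hypersurface is an immersion \<open>f\<close> of a smooth 3-manifold, which carries the
  induced metric, together with a globally defined unit normal field \<open>N\<close>, regarded as a vector
  field along \<open>f\<close>.\<close>

definition sol_hypersurface ::
  "'m topology \<Rightarrow> (real ^ 3, 'm) atlas \<Rightarrow> ('m \<Rightarrow> real ^ 4) \<Rightarrow> ('m \<Rightarrow> real ^ 4) \<Rightarrow> bool" where
  "sol_hypersurface M \<A> f N \<longleftrightarrow>
     smooth_manifold M \<A> \<and>
     (\<forall>(V, \<phi>)\<in>\<A>.
        smooth_map_on (f \<circ> \<phi>) V \<and> smooth_map_on (N \<circ> \<phi>) V \<and>
        (\<forall>u\<in>V. inj (frechet_derivative (f \<circ> \<phi>) (at u)) \<and>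
               (\<forall>v. sol_metric (f (\<phi> u)) (N (\<phi> u)) (frechet_derivative (f \<circ> \<phi>) (at u) v) = 0) \<and>
               sol_metric (f (\<phi> u)) (N (\<phi> u)) (N (\<phi> u)) = 1))"

definition angle_function ::
  "('m \<Rightarrow> real ^ 4) \<Rightarrow> ('m \<Rightarrow> real ^ 4) \<Rightarrow> (real ^ 4 \<Rightarrow> real ^ 4) \<Rightarrow> 'm \<Rightarrow> real" where
  "angle_function f N E p = sol_metric (f p) (N p) (E (f p))"

text \<open>Covariant derivative at \<open>u\<close>, in the direction \<open>v\<close> of the parameter space, of a vector field
  \<open>Y\<close> along a parametrized hypersurface \<open>F\<close>.\<close>

definition covariant_derivative ::
  "(real ^ 3 \<Rightarrow> real ^ 4) \<Rightarrow> (real ^ 3 \<Rightarrow> real ^ 4) \<Rightarrow> real ^ 3 \<Rightarrow> real ^ 3 \<Rightarrow> real ^ 4" where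
  "covariant_derivative F Y u v =
     frechet_derivative Y (at u) v + sol_christoffel (F u) (frechet_derivative F (at u) v) (Y u)"

text \<open>The shape operator, acting on vectors \<open>X\<close> in the tangent space
  \<open>range (frechet_derivative F (at u))\<close>.\<close>

definition shape_operator ::
  "(real ^ 3 \<Rightarrow> real ^ 4) \<Rightarrow> (real ^ 3 \<Rightarrow> real ^ 4) \<Rightarrow> real ^ 3 \<Rightarrow> real ^ 4 \<Rightarrow> real ^ 4" where
  "shape_operator F \<nu> u X =
     - covariant_derivative F \<nu> u (the_inv (frechet_derivative F (at u)) X)"

text \<open>Multiplicity of \<open>\<kappa>\<close> as a principal curvature (0 if it is none). The shape operator is
  self-adjoint, so there is no difference between geometric and algebraic multiplicities.\<close>

definition principal_multiplicity ::
  "(real ^ 3 \<Rightarrow> real ^ 4) \<Rightarrow> (real ^ 3 \<Rightarrow> real ^ 4) \<Rightarrow> real ^ 3 \<Rightarrow> real \<Rightarrow> nat" where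
  "principal_multiplicity F \<nu> u \<kappa> =
     dim {X \<in> range (frechet_derivative F (at u)). shape_operator F \<nu> u X = \<kappa> *\<^sub>R X}"

definition constant_principal_curvatures ::
  "(real ^ 3, 'm) atlas \<Rightarrow> ('m \<Rightarrow> real ^ 4) \<Rightarrow> ('m \<Rightarrow> real ^ 4) \<Rightarrow> bool" where
  "constant_principal_curvatures \<A> f N \<longleftrightarrow>
     (\<forall>(V, \<phi>)\<in>\<A>. \<forall>u\<in>V. \<forall>(W, \<psi>)\<in>\<A>. \<forall>w\<in>W. \<forall>\<kappa>.
        principal_multiplicity (f \<circ> \<phi>) (N \<circ> \<phi>) u \<kappa> = principal_multiplicity (f \<circ> \<psi>) (N \<circ> \<psi>) w \<kappa>)"

text \<open>At every point, the principal curvatures with respect to \<open>N\<close>, listed with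
  multiplicities, are those in \<open>C\<close>.\<close>

definition has_principal_curvatures ::
  "(real ^ 3, 'm) atlas \<Rightarrow> ('m \<Rightarrow> real ^ 4) \<Rightarrow> ('m \<Rightarrow> real ^ 4) \<Rightarrow> real multiset \<Rightarrow> bool" where
  "has_principal_curvatures \<A> f N C \<longleftrightarrow>
     (\<forall>(V, \<phi>)\<in>\<A>. \<forall>u\<in>V. \<forall>\<kappa>. principal_multiplicity (f \<circ> \<phi>) (N \<circ> \<phi>) u \<kappa> = count C \<kappa>)"

definition open_part :: "'a::topological_space set \<Rightarrow> 'a set \<Rightarrow> bool" where
  "open_part S T \<longleftrightarrow> openin (top_of_set T) S"


section \<open>The model hypersurfaces\<close>

definition sech :: "real \<Rightarrow> real" where "sech r = 1 / cosh r"
definition coth :: "real \<Rightarrow> real" where "coth r = cosh r / sinh r"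

definition sol_M1 :: "real \<Rightarrow> (real ^ 4) set" where
  "sol_M1 r = {vector [exp x3 * cos x1 * tanh r, exp x3 * sin x1 * tanh r, x2, x3 + ln (sech r)]
                | x1 x2 x3. True}"

definition sol_M2 :: "real \<Rightarrow> (real ^ 4) set" where
  "sol_M2 r = {vector [x1, exp x3 * tanh r, x2, x3 + ln (sech r)] | x1 x2 x3. True}"

definition sol_M3 :: "real \<Rightarrow> (real ^ 4) set" where
  "sol_M3 r = {vector [x1, x2, 1 / 2 * exp (- 2 * x3) * tanh (2 * r), x3 + 1 / 2 * ln (cosh (2 * r))]
                | x1 x2 x3. True}"

definition sol_M4_0 :: "(real ^ 4) set" where
  "sol_M4_0 = {vector [x, y, z, 0] | x y z. True}"

end

theory Submission
  imports Defs
begin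

text \<open>The normal is \<open>N = a E\<^sub>1 + b E\<^sub>2 + c E\<^sub>3 + d E\<^sub>4\<close> with \<open>c\<close> and \<open>d\<close> constant, hence
  \<open>a\<^sup>2 + b\<^sup>2\<close> is constant. If it vanishes, the form \<open>g(N, \<cdot>)\<close> has an explicit first integral, whose
  level sets are the surfaces of cases (3) and (4). Otherwise symmetry of the second fundamental
  form forces \<open>c = 0\<close>, and \<open>(a, b)\<close> rotates only along the principal direction
  \<open>- b E\<^sub>1 + a E\<^sub>2\<close>, at a rate \<open>m\<close> that is determined by the corresponding principal curvature
  and therefore constant. Equality of the mixed second derivatives of \<open>a\<close> and \<open>b\<close> gives
  \<open>m = 0\<close> or \<open>m d = - 1\<close>. In the first case \<open>a\<close> and \<open>b\<close> are constant and
  \<open>a x + b y + d e\<^sup>t\<close> is a first integral, which yields case (2); in the second one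
  \<open>x + d e\<^sup>t a / (1 - d\<^sup>2)\<close> and \<open>y + d e\<^sup>t b / (1 - d\<^sup>2)\<close> are first integrals, which yields case (1).\<close>

section \<open>Symmetry of second derivatives and multiplicities\<close>

text \<open>The mean value theorem in direction \<open>u\<close>, applied to the increment of
  \<open>f\<close> along \<open>s *\<^sub>R v\<close>, turns the second difference into
  \<open>s\<close> times an increment of \<open>\<lambda>y. f' y u\<close>. Differentiability of
  that function at the single point \<open>x\<close> gives this increment up to o(s).\<close>

lemma second_difference_quotient_tendsto:
  fixes f :: "'a::real_normed_vector \<Rightarrow> real"
  assumes "open S" "x \<in> S"
    and f': "\<And>y. y \<in> S \<Longrightarrow> (f has_derivative f' y) (at y)"
    and A: "((\<lambda>y. f' y u) has_derivative A) (at x)"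
  shows "((\<lambda>s. (f (x + s *\<^sub>R u + s *\<^sub>R v) - f (x + s *\<^sub>R u) - f (x + s *\<^sub>R v) + f x) / s\<^sup>2)
           \<longlongrightarrow> A v) (at_right 0)"
proof (rule tendstoI)
  fix e :: real
  assume "e > 0"
  \<comment> \<open>All points of the parallelogram spanned by \<open>s *\<^sub>R u\<close> and
    \<open>s *\<^sub>R v\<close> lie within \<open>s * K\<close> of \<open>x\<close>. Two estimates
    with \<open>e'\<close> will cost \<open>2 * e' * K\<close>, which is less than
    \<open>e\<close>.\<close>
  define K where "K = norm u + norm v + 1"
  have K: "K > 0"
    unfolding K_def by (simp add: add_nonneg_pos)
  define e' where "e' = e / (3 * K)"
  have e': "e' > 0"
    using \<open>e > 0\<close> K by (simp add: e'_def)
  obtain r where r: "r > 0" "\<And>y. norm (y - x) < r \<Longrightarrow> y \<in> S"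
    using \<open>open S\<close> \<open>x \<in> S\<close> unfolding open_dist by (metis dist_norm)
  obtain d where d: "d > 0"
    "\<And>y. norm (y - x) < d \<Longrightarrow> norm (f' y u - f' x u - A (y - x)) \<le> e' * norm (y - x)"
    using A e' unfolding has_derivative_at_alt by meson
  have linA: "linear A"
    using A has_derivative_linear by blast
  have ev: "\<forall>\<^sub>F s in at_right 0. 0 < s \<and> s < min r d / K"
    using eventually_at_right_real[of 0 "min r d / K"] K r(1) d(1) by simp
  show "\<forall>\<^sub>F s in at_right 0. dist ((f (x + s *\<^sub>R u + s *\<^sub>R v) - f (x + s *\<^sub>R u)
           - f (x + s *\<^sub>R v) + f x) / s\<^sup>2) (A v) < e"
    using ev
  proof eventually_elim
    case (elim s)
    then have s: "0 < s" "s * K < r" "s * K < d"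
      using K by (auto simp: field_simps)
    have small: "norm (\<tau> *\<^sub>R u + \<sigma> *\<^sub>R v) \<le> s * K" if "0 \<le> \<tau>" "\<tau> \<le> s" "0 \<le> \<sigma>" "\<sigma> \<le> s" for \<tau> \<sigma>
    proof -
      have "norm (\<tau> *\<^sub>R u + \<sigma> *\<^sub>R v) \<le> \<tau> * norm u + \<sigma> * norm v"
        using norm_triangle_ineq[of "\<tau> *\<^sub>R u" "\<sigma> *\<^sub>R v"] that by simp
      also have "\<dots> \<le> s * norm u + s * norm v"
        using that by (intro add_mono mult_right_mono) auto
      also have "\<dots> \<le> s * K"
        using s by (simp add: K_def distrib_left)
      finally show ?thesis .
    qed
    \<comment> \<open>The vanishing summand \<open>0 *\<^sub>R v\<close> is kept so that both terms
      are instances of one derivative rule, with \<sigma> = s and \<sigma> = 0.\<close>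
    define \<phi> where "\<phi> \<tau> = f (x + (\<tau> *\<^sub>R u + s *\<^sub>R v)) - f (x + (\<tau> *\<^sub>R u + 0 *\<^sub>R v))" for \<tau>
    have "(\<phi> has_real_derivative
        f' (x + (\<tau> *\<^sub>R u + s *\<^sub>R v)) u - f' (x + (\<tau> *\<^sub>R u + 0 *\<^sub>R v)) u) (at \<tau>)"
      if "0 \<le> \<tau>" "\<tau> \<le> s" for \<tau>
    proof -
      have *: "((\<lambda>\<tau>. f (x + (\<tau> *\<^sub>R u + \<sigma> *\<^sub>R v))) has_real_derivative
          f' (x + (\<tau> *\<^sub>R u + \<sigma> *\<^sub>R v)) u) (at \<tau>)" if "0 \<le> \<sigma>" "\<sigma> \<le> s" for \<sigma>
      proof -
        have mem: "x + (\<tau> *\<^sub>R u + \<sigma> *\<^sub>R v) \<in> S"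
          using small[of \<tau> \<sigma>] that \<open>0 \<le> \<tau>\<close> \<open>\<tau> \<le> s\<close> s by (intro r(2)) auto
        have "((\<lambda>\<tau>. x + (\<tau> *\<^sub>R u + \<sigma> *\<^sub>R v)) has_derivative (\<lambda>h. h *\<^sub>R u)) (at \<tau>)"
          by (auto intro!: derivative_eq_intros)
        from has_derivative_compose[OF this f'[OF mem]] show ?thesis
          unfolding has_field_derivative_def
          using linear_scale[OF has_derivative_linear[OF f'[OF mem]]]
          by (simp add: mult_commute_abs)
      qed
      show ?thesis
        unfolding \<phi>_def using s by (intro DERIV_diff *) auto
    qed
    from MVT2[OF s(1) this] obtain z where z: "0 < z" "z < s"
      and eq: "\<phi> s - \<phi> 0 = s * (f' (x + (z *\<^sub>R u + s *\<^sub>R v)) u - f' (x + (z *\<^sub>R u + 0 *\<^sub>R v)) u)"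
      by auto
    have est: "\<bar>f' (x + h) u - f' x u - A h\<bar> \<le> e' * (s * K)" if "norm h \<le> s * K" for h
    proof -
      have "\<bar>f' (x + h) u - f' x u - A h\<bar> \<le> e' * norm h"
        using d(2)[of "x + h"] that s by simp
      also have "\<dots> \<le> e' * (s * K)"
        using that e' by (intro mult_left_mono) auto
      finally show ?thesis .
    qed
    have "\<bar>f' (x + (z *\<^sub>R u + s *\<^sub>R v)) u - f' x u - A (z *\<^sub>R u + s *\<^sub>R v)\<bar> \<le> e' * (s * K)"
         "\<bar>f' (x + (z *\<^sub>R u + 0 *\<^sub>R v)) u - f' x u - A (z *\<^sub>R u + 0 *\<^sub>R v)\<bar> \<le> e' * (s * K)"
      using z s by (auto intro!: est small simp del: scaleR_zero_left)
    \<comment> \<open>By linearity the two values of \<open>A\<close> differ by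
      \<open>s * A v\<close>, so the unknown intermediate point \<open>z\<close> drops out.\<close>
    then have "\<bar>(\<phi> s - \<phi> 0) / s - s * A v\<bar> \<le> 2 * e' * K * s"
      unfolding eq nonzero_mult_div_cancel_left[OF less_imp_neq[OF s(1), symmetric]] using s
      by (simp add: linear_add[OF linA] linear_scale[OF linA] algebra_simps abs_le_iff)
    then have "\<bar>((\<phi> s - \<phi> 0) / s - s * A v) / s\<bar> \<le> 2 * e' * K"
      using s by (simp add: abs_divide divide_le_eq)
    moreover have "((\<phi> s - \<phi> 0) / s - s * A v) / s = (\<phi> s - \<phi> 0) / s\<^sup>2 - A v"
      using s by (simp add: field_simps power2_eq_square)
    moreover have "2 * e' * K < e"
      using K \<open>e > 0\<close> by (simp add: e'_def)
    ultimately have "\<bar>(\<phi> s - \<phi> 0) / s\<^sup>2 - A v\<bar> < e"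
      by linarith
    then show ?case
      by (simp add: dist_real_def \<phi>_def algebra_simps)
  qed
qed

text \<open>The second difference is symmetric in \<open>u\<close> and \<open>v\<close>, so its
  quotient tends both to \<open>A v\<close> and to \<open>B u\<close>.\<close>

lemma symmetric_second_derivative:
  fixes f :: "'a::real_normed_vector \<Rightarrow> real"
  assumes "open S" "x \<in> S"
    and "\<And>y. y \<in> S \<Longrightarrow> (f has_derivative f' y) (at y)"
    and "((\<lambda>y. f' y u) has_derivative A) (at x)"
    and "((\<lambda>y. f' y v) has_derivative B) (at x)"
  shows "A v = B u"
proof (rule tendsto_unique[OF _ second_difference_quotient_tendsto[OF assms(1-4)]])
  show "((\<lambda>s. (f (x + s *\<^sub>R u + s *\<^sub>R v) - f (x + s *\<^sub>R u) - f (x + s *\<^sub>R v) + f x) / s\<^sup>2)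
           \<longlongrightarrow> B u) (at_right 0)"
    using second_difference_quotient_tendsto[OF assms(1-3,5), of u] by (simp add: algebra_simps)
qed simp

section \<open>Multiplicities of principal curvatures from an eigenbasis\<close>

lemma vec3_eq_iff: "x = y \<longleftrightarrow> x$1 = y$1 \<and> x$2 = y$2 \<and> x$3 = y$3" for x y :: "'a ^ 3"
  by (simp add: vec_eq_iff forall_3)

lemma count_eq_card_index: "count {#k$1, k$2, k$3#} \<kappa> = card {i::3. k$i = \<kappa>}"
proof -
  have "{i::3. k$i = \<kappa>} = (if k$1 = \<kappa> then {1} else {}) \<union> (if k$2 = \<kappa> then {2} else {})
      \<union> (if k$3 = \<kappa> then {3} else {})"
    (is "?A = ?B")
  proof (rule set_eqI)
    show "i \<in> ?A \<longleftrightarrow> i \<in> ?B" for i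
      using exhaust_3[of i] by auto
  qed
  then show ?thesis by auto
qed

lemma linear_christoffel: "linear (\<lambda>X. sol_christoffel p X Y)" "linear (sol_christoffel p X)"
  unfolding sol_christoffel_eq
  by (auto intro!: linearI simp: vec_eq_iff forall_4 algebra_simps)

text \<open>In the coordinates \<open>B\<close> given by an eigenbasis the shape operator is
  diagonal with entries \<open>\<epsilon> * k$i\<close>. Stating the eigenvalue equations for
  \<open>covariant_derivative\<close> avoids the inverse of \<open>L\<close> inside
  \<open>shape_operator\<close>; the factor \<epsilon> covers both signs of the normal.\<close>

lemma principal_multiplicity_eq_count:
  fixes F \<nu> :: "real ^ 3 \<Rightarrow> real ^ 4" and u :: "real ^ 3" and e :: "3 \<Rightarrow> real ^ 3" and k :: "real ^ 3"
  defines "L \<equiv> frechet_derivative F (at u)"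
  assumes F: "F differentiable (at u)" and \<nu>: "\<nu> differentiable (at u)" and inj: "inj L"
    and indep: "\<And>x :: real ^ 3. x$1 *\<^sub>R e 1 + x$2 *\<^sub>R e 2 + x$3 *\<^sub>R e 3 = 0 \<Longrightarrow> x = 0"
    and eig: "\<And>i. covariant_derivative F \<nu> u (e i) = - k$i *\<^sub>R L (e i)"
  shows "principal_multiplicity F (\<lambda>p. \<epsilon> *\<^sub>R \<nu> p) u \<kappa>
    = count {#\<epsilon> * k$1, \<epsilon> * k$2, \<epsilon> * k$3#} \<kappa>"
proof -
  define B :: "real ^ 3 \<Rightarrow> real ^ 3" where "B x = x$1 *\<^sub>R e 1 + x$2 *\<^sub>R e 2 + x$3 *\<^sub>R e 3" for x
  define kx :: "real ^ 3 \<Rightarrow> real ^ 3" where "kx x = (\<chi> i. k$i * x$i)" for x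
  have linB: "linear B"
    by (auto intro!: linearI simp: B_def algebra_simps)
  have injB: "inj B"
    using indep linear_injective_0[OF linB] unfolding B_def by blast
  then have surjB: "surj B"
    using linB linear_injective_imp_surjective by blast
  have linL: "linear L"
    unfolding L_def using F linear_frechet_derivative by blast
  have linC: "linear (covariant_derivative F \<nu> u)"
    unfolding covariant_derivative_def
    using linear_compose_add[OF linear_frechet_derivative[OF \<nu>]
        linear_compose[OF linL linear_christoffel(1)]]
    by (simp add: o_def L_def)
  have cov: "covariant_derivative F \<nu> u (B x) = - L (B (kx x))" for x
    by (simp add: B_def linear_add[OF linC] linear_scale[OF linC] eig linear_add[OF linL]
        linear_scale[OF linL] kx_def mult.commute)
  have "frechet_derivative (\<lambda>p. \<epsilon> *\<^sub>R \<nu> p) (at u) = (\<lambda>v. \<epsilon> *\<^sub>R frechet_derivative \<nu> (at u) v)"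
    using has_derivative_scaleR_right[OF \<nu>[unfolded frechet_derivative_works]]
    by (rule frechet_derivative_at[symmetric])
  then have "covariant_derivative F (\<lambda>p. \<epsilon> *\<^sub>R \<nu> p) u v = \<epsilon> *\<^sub>R covariant_derivative F \<nu> u v" for v
    unfolding covariant_derivative_def
    by (simp add: linear_scale[OF linear_christoffel(2)] scaleR_add_right)
  then have shape: "shape_operator F (\<lambda>p. \<epsilon> *\<^sub>R \<nu> p) u (L (B x)) = L (B (\<epsilon> *\<^sub>R kx x))" for x
    unfolding shape_operator_def L_def[symmetric] the_inv_f_f[OF inj]
    by (simp add: cov linear_scale[OF linB] linear_scale[OF linL])
  have injLB: "inj (L \<circ> B)"
    using inj injB by (rule inj_compose)
  have "{X \<in> range L. shape_operator F (\<lambda>p. \<epsilon> *\<^sub>R \<nu> p) u X = \<kappa> *\<^sub>R X}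
      = (L \<circ> B) ` {x. \<epsilon> *\<^sub>R kx x = \<kappa> *\<^sub>R x}"
  proof -
    have "range L = (L \<circ> B) ` UNIV"
      using surjB by (metis image_comp)
    moreover have "shape_operator F (\<lambda>p. \<epsilon> *\<^sub>R \<nu> p) u (L (B x)) = \<kappa> *\<^sub>R L (B x)
        \<longleftrightarrow> \<epsilon> *\<^sub>R kx x = \<kappa> *\<^sub>R x" for x
      unfolding shape using injLB
      by (simp flip: linear_scale[OF linL] linear_scale[OF linB] add: inj_eq[OF inj] inj_eq[OF injB])
    ultimately show ?thesis by auto
  qed
  \<comment> \<open>An eigenspace of a diagonal matrix is a coordinate subspace, so its dimension
    counts the indices with eigenvalue \<kappa>.\<close>
  moreover have "{x. \<epsilon> *\<^sub>R kx x = \<kappa> *\<^sub>R x} = {x. \<forall>i. i \<notin> {i. \<epsilon> * k$i = \<kappa>} \<longrightarrow> x$i = 0}"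
    by (auto simp: vec_eq_iff kx_def)
  ultimately have "principal_multiplicity F (\<lambda>p. \<epsilon> *\<^sub>R \<nu> p) u \<kappa> = card {i. \<epsilon> * k$i = \<kappa>}"
    unfolding principal_multiplicity_def L_def[symmetric]
    using dim_image_eq[OF linear_compose[OF linB linL] inj_on_subset[OF injLB subset_UNIV]]
      dim_substandard_cart[of "{i. \<epsilon> * k$i = \<kappa>}", where ?'a = real]
    by (simp flip: dim_vec_eq)
  then show ?thesis
    using count_eq_card_index[of "\<chi> i. \<epsilon> * k$i" \<kappa>] by simp
qed

section \<open>Structure equations of a parametrized patch\<close>

lemma has_derivative_nth [derivative_intros]:
  "(f has_derivative f') F \<Longrightarrow> ((\<lambda>x. f x $ i) has_derivative (\<lambda>v. f' v $ i)) F"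
  by (rule bounded_linear.has_derivative[OF bounded_linear_vec_nth])

text \<open>Components of a tangent vector at \<open>p\<close> in the orthonormal frame E_1, ...,
  E_4. In them the metric becomes the Euclidean inner product.\<close>

definition sol_frame :: "real ^ 4 \<Rightarrow> real ^ 4 \<Rightarrow> real ^ 4" where
  "sol_frame p X = vector [exp (- p$4) * X$1, exp (- p$4) * X$2, exp (2 * p$4) * X$3, X$4]"

lemma sol_frame_nth [simp]:
  "sol_frame p X $ 1 = exp (- p$4) * X$1" "sol_frame p X $ 2 = exp (- p$4) * X$2"
  "sol_frame p X $ 3 = exp (2 * p$4) * X$3" "sol_frame p X $ 4 = X$4"
  by (simp_all add: sol_frame_def)

lemma vec4_eq_iff:
  "X = Y \<longleftrightarrow> X$1 = Y$1 \<and> X$2 = Y$2 \<and> X$3 = Y$3 \<and> X$4 = Y$4" for X Y :: "'a ^ 4"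
  by (simp add: vec_eq_iff forall_4)

lemma sol_frame_inject [simp]: "sol_frame p X = sol_frame p Y \<longleftrightarrow> X = Y"
  by (simp add: vec4_eq_iff)

lemma linear_sol_frame: "linear (sol_frame p)"
  by (auto intro!: linearI simp: vec4_eq_iff algebra_simps)

lemma inner_vec4: "X \<bullet> Y = X$1 * Y$1 + X$2 * Y$2 + X$3 * Y$3 + X$4 * Y$4" for X Y :: "real ^ 4"
  by (simp add: inner_vec_def sum_4)

lemma sol_metric_eq_inner_frame: "sol_metric p X Y = sol_frame p X \<bullet> sol_frame p Y"
proof -
  have "exp (- 2 * p$4) = exp (- p$4) * exp (- p$4)" "exp (4 * p$4) = exp (2 * p$4) * exp (2 * p$4)"
    by (simp_all flip: exp_add)
  then show ?thesis
    by (simp add: sol_metric_def inner_vec4 algebra_simps)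
qed

lemma frechet_derivative_eqI: "(f has_derivative f') (at x) \<Longrightarrow> frechet_derivative f (at x) v = f' v"
  using frechet_derivative_at by metis

text \<open>One chart of the hypersurface, with \<open>F\<close> and \<nu> in the roles of
  \<open>f \<circ> \<phi>\<close> and \<open>N \<circ> \<phi>\<close>; all differentiation then
  takes place on an open subset of \<open>real ^ 3\<close>.\<close>

locale sol_patch =
  fixes V :: "(real ^ 3) set" and F \<nu> :: "real ^ 3 \<Rightarrow> real ^ 4" and c d :: real
  assumes open_V: "open V"
    and smooth_F: "smooth_map_on F V" and smooth_\<nu>: "smooth_map_on \<nu> V"
    and inj_F': "u \<in> V \<Longrightarrow> inj (frechet_derivative F (at u))"
    and normal: "u \<in> V \<Longrightarrow> sol_metric (F u) (\<nu> u) (frechet_derivative F (at u) v) = 0"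
    and unit: "u \<in> V \<Longrightarrow> sol_metric (F u) (\<nu> u) (\<nu> u) = 1"
    and angle_E3: "u \<in> V \<Longrightarrow> sol_metric (F u) (\<nu> u) (sol_E3 (F u)) = c"
    and angle_E4: "u \<in> V \<Longrightarrow> sol_metric (F u) (\<nu> u) (sol_E4 (F u)) = d"
begin

definition F' :: "real ^ 3 \<Rightarrow> real ^ 3 \<Rightarrow> real ^ 4" where
  "F' u = frechet_derivative F (at u)"

definition F'' :: "real ^ 3 \<Rightarrow> real ^ 3 \<Rightarrow> real ^ 3 \<Rightarrow> real ^ 4" where
  "F'' u v = frechet_derivative (\<lambda>p. F' p v) (at u)"

text \<open>The component \<open>\<omega> u v $ i\<close> is the pullback under \<open>F\<close> of
  the 1-form dual to E_i, evaluated on \<open>v\<close>.\<close>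

definition \<omega> :: "real ^ 3 \<Rightarrow> real ^ 3 \<Rightarrow> real ^ 4" where
  "\<omega> u v = sol_frame (F u) (F' u v)"

text \<open>The angle functions \<open>a\<close> and \<open>b\<close> in the parameter domain.\<close>

definition \<alpha> :: "real ^ 3 \<Rightarrow> real" where "\<alpha> u = sol_frame (F u) (\<nu> u) $ 1"
definition \<beta> :: "real ^ 3 \<Rightarrow> real" where "\<beta> u = sol_frame (F u) (\<nu> u) $ 2"

definition \<alpha>' :: "real ^ 3 \<Rightarrow> real ^ 3 \<Rightarrow> real" where
  "\<alpha>' u = frechet_derivative \<alpha> (at u)"
definition \<beta>' :: "real ^ 3 \<Rightarrow> real ^ 3 \<Rightarrow> real" where
  "\<beta>' u = frechet_derivative \<beta> (at u)"

lemma F_deriv [derivative_intros]: "u \<in> V \<Longrightarrow> (F has_derivative F' u) (at u)"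
  using smooth_F[unfolded smooth_map_on_def, THEN spec[of _ 1]]
  by (simp add: F'_def flip: frechet_derivative_works)

lemma \<nu>_deriv: "u \<in> V \<Longrightarrow> (\<nu> has_derivative frechet_derivative \<nu> (at u)) (at u)"
  using smooth_\<nu>[unfolded smooth_map_on_def, THEN spec[of _ 1]]
  by (simp flip: frechet_derivative_works)

lemma F'_deriv: "u \<in> V \<Longrightarrow> ((\<lambda>p. F' p v) has_derivative F'' u v) (at u)"
  using smooth_F[unfolded smooth_map_on_def, THEN spec[of _ 2]]
  by (simp add: F'_def F''_def numeral_2_eq_2 flip: frechet_derivative_works)

lemma F''_commute:
  assumes "u \<in> V"
  shows "F'' u v w = F'' u w v"
proof -
  have "F'' u v w $ i = F'' u w v $ i" for i
    by (rule symmetric_second_derivative[OF open_V assms, where f = "\<lambda>p. F p $ i"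
          and f' = "\<lambda>p v. F' p v $ i"])
      (auto intro!: derivative_intros F'_deriv assms)
  then show ?thesis by (simp add: vec_eq_iff)
qed

lemma linear_\<omega>: "u \<in> V \<Longrightarrow> linear (\<omega> u)"
  using linear_compose[OF has_derivative_linear[OF F_deriv] linear_sol_frame, of u "F u"]
  by (simp add: \<omega>_def[abs_def] o_def)

lemma \<omega>_eq_0_iff: "u \<in> V \<Longrightarrow> \<omega> u v = 0 \<longleftrightarrow> v = 0"
  using linear_\<omega> inj_F'
  by (metis F'_def \<omega>_def injD linear_0 sol_frame_inject)

lemma frame_\<nu>:
  assumes "u \<in> V"
  shows "sol_frame (F u) (\<nu> u) = vector [\<alpha> u, \<beta> u, c, d]"
  using angle_E3[OF assms] angle_E4[OF assms]
  by (simp add: \<alpha>_def \<beta>_def vec4_eq_iff sol_metric_eq_inner_frame inner_vec4 sol_E3_def sol_E4_def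
      flip: exp_add)

lemma \<nu>_nth:
  assumes "u \<in> V"
  shows "\<nu> u $ 1 = exp (F u $ 4) * \<alpha> u" "\<nu> u $ 2 = exp (F u $ 4) * \<beta> u"
    "\<nu> u $ 3 = exp (- 2 * F u $ 4) * c" "\<nu> u $ 4 = d"
  using frame_\<nu>[OF assms] by (auto simp: vec4_eq_iff exp_minus field_simps)

lemma \<alpha>\<beta>_unit: "u \<in> V \<Longrightarrow> (\<alpha> u)\<^sup>2 + (\<beta> u)\<^sup>2 = 1 - c\<^sup>2 - d\<^sup>2"
  using unit[of u] by (simp add: sol_metric_eq_inner_frame frame_\<nu> inner_vec4 power2_eq_square)

lemma tangent_relation:
  "u \<in> V \<Longrightarrow> \<alpha> u * \<omega> u v $ 1 + \<beta> u * \<omega> u v $ 2 + c * \<omega> u v $ 3 + d * \<omega> u v $ 4 = 0"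
  using normal[of u v]
  unfolding sol_metric_eq_inner_frame by (simp only: frame_\<nu> inner_vec4 vector_4 \<omega>_def F'_def)

text \<open>A dimension count: \<omega> is injective, so its range is 3-dimensional and fills the
  hyperplane orthogonal to the normal. This is the source of all tangent vectors with prescribed
  frame components below.\<close>

lemma ex_tangent_vector:
  assumes "u \<in> V" and X: "\<alpha> u * X1 + \<beta> u * X2 + c * X3 + d * X4 = 0"
  shows "\<exists>v. \<omega> u v = vector [X1, X2, X3, X4]"
proof -
  define n :: "real ^ 4" where "n = vector [\<alpha> u, \<beta> u, c, d]"
  have "n \<noteq> 0"
    using \<alpha>\<beta>_unit[OF assms(1)] by (auto simp: n_def vec4_eq_iff)
  have inj: "inj (\<omega> u)"
    using linear_injective_0[OF linear_\<omega>[OF assms(1)]] \<omega>_eq_0_iff[OF assms(1)] by blast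
  have "dim (range (\<omega> u)) = 3"
    using dim_image_eq[OF linear_\<omega>[OF assms(1)] inj_on_subset[OF inj subset_UNIV], of UNIV] by simp
  moreover have "dim {X. n \<bullet> X = 0} = 3"
    using dim_hyperplane[OF \<open>n \<noteq> 0\<close>] by simp
  moreover have "range (\<omega> u) \<subseteq> {X. n \<bullet> X = 0}"
    using tangent_relation[OF assms(1)] by (auto simp: n_def inner_vec4)
  ultimately have "range (\<omega> u) = {X. n \<bullet> X = 0}"
    by (intro subspace_dim_equal linear_subspace_image linear_\<omega> assms subspace_hyperplane) auto
  moreover have "vector [X1, X2, X3, X4] \<in> {X. n \<bullet> X = 0}"
    using X by (simp add: n_def inner_vec4)
  ultimately show ?thesis by (metis imageE)
qed

lemma \<alpha>_deriv [derivative_intros]: "u \<in> V \<Longrightarrow> (\<alpha> has_derivative \<alpha>' u) (at u)"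
  and \<beta>_deriv [derivative_intros]: "u \<in> V \<Longrightarrow> (\<beta> has_derivative \<beta>' u) (at u)"
proof -
  assume "u \<in> V"
  have "((\<lambda>p. exp (- F p $ 4) * \<nu> p $ i) has_derivative
      (\<lambda>v. exp (- F u $ 4) * (frechet_derivative \<nu> (at u) v $ i - F' u v $ 4 * \<nu> u $ i))) (at u)" for i
    using \<open>u \<in> V\<close> by (auto intro!: derivative_eq_intros \<nu>_deriv simp: algebra_simps)
  then have "\<alpha> differentiable (at u)" "\<beta> differentiable (at u)"
    unfolding \<alpha>_def[abs_def] \<beta>_def[abs_def] sol_frame_nth differentiable_def by blast+
  then show "(\<alpha> has_derivative \<alpha>' u) (at u)" "(\<beta> has_derivative \<beta>' u) (at u)"
    by (simp_all add: \<alpha>'_def \<beta>'_def flip: frechet_derivative_works)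
qed

lemma \<alpha>\<beta>_deriv_orthogonal:
  assumes "u \<in> V"
  shows "\<alpha> u * \<alpha>' u v + \<beta> u * \<beta>' u v = 0"
proof -
  have "((\<lambda>p. (\<alpha> p)\<^sup>2 + (\<beta> p)\<^sup>2) has_derivative (\<lambda>v. 2 * (\<alpha> u * \<alpha>' u v + \<beta> u * \<beta>' u v))) (at u)"
    using assms by (auto intro!: derivative_eq_intros simp: algebra_simps)
  moreover have "((\<lambda>p. (\<alpha> p)\<^sup>2 + (\<beta> p)\<^sup>2) has_derivative (\<lambda>v. 0)) (at u)"
    by (rule has_derivative_transform_within_open[OF has_derivative_const open_V assms])
      (simp add: \<alpha>\<beta>_unit)
  ultimately have "(\<lambda>v. 2 * (\<alpha> u * \<alpha>' u v + \<beta> u * \<beta>' u v)) = (\<lambda>v. 0)"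
    by (rule has_derivative_unique)
  then show ?thesis
    by (auto dest: fun_cong[of _ _ v])
qed

text \<open>The connection terms come from \<nabla>_{E_1} E_4 = -E_1, \<nabla>_{E_1} E_1 = E_4
  (likewise for E_2), \<nabla>_{E_3} E_4 = 2 E_3 and \<nabla>_{E_3} E_3 = -2 E_4. As
  \<open>c\<close> and \<open>d\<close> are constant, only \<alpha> and \<beta> contribute
  derivatives.\<close>

lemma frame_covariant_derivative:
  assumes "u \<in> V"
  shows "sol_frame (F u) (covariant_derivative F \<nu> u v) =
    vector [\<alpha>' u v - d * \<omega> u v $ 1, \<beta>' u v - d * \<omega> u v $ 2, 2 * d * \<omega> u v $ 3,
      \<alpha> u * \<omega> u v $ 1 + \<beta> u * \<omega> u v $ 2 - 2 * c * \<omega> u v $ 3]"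
proof -
  define \<nu>' where "\<nu>' = frechet_derivative \<nu> (at u)"
  have \<nu>': "(\<nu> has_derivative \<nu>') (at u)"
    using \<nu>_deriv[OF assms] by (simp add: \<nu>'_def)
  have *: "\<nu>' v $ i = h' v"
    if "\<And>p. p \<in> V \<Longrightarrow> \<nu> p $ i = h p" "(h has_derivative h') (at u)" for i h h'
  proof -
    have "((\<lambda>p. \<nu> p $ i) has_derivative h') (at u)"
      by (rule has_derivative_transform_within_open[OF that(2) open_V assms]) (simp add: that(1))
    then show ?thesis
      using has_derivative_unique[OF has_derivative_nth[OF \<nu>']] by metis
  qed
  have d1: "\<nu>' v $ 1 = exp (F u $ 4) * (F' u v $ 4 * \<alpha> u + \<alpha>' u v)"
    by (rule *[OF \<nu>_nth(1)]) (use assms in \<open>auto intro!: derivative_eq_intros simp: algebra_simps\<close>)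
  have d2: "\<nu>' v $ 2 = exp (F u $ 4) * (F' u v $ 4 * \<beta> u + \<beta>' u v)"
    by (rule *[OF \<nu>_nth(2)]) (use assms in \<open>auto intro!: derivative_eq_intros simp: algebra_simps\<close>)
  have d3: "\<nu>' v $ 3 = - 2 * F' u v $ 4 * exp (- 2 * F u $ 4) * c"
    by (rule *[OF \<nu>_nth(3)]) (use assms in \<open>auto intro!: derivative_eq_intros simp: algebra_simps\<close>)
  have d4: "\<nu>' v $ 4 = 0"
    by (rule *[OF \<nu>_nth(4)]) auto
  \<comment> \<open>All exponentials become powers of one nonzero number, which leaves a rational
    identity.\<close>
  obtain E where E: "E \<noteq> 0" "exp (F u $ 4) = E" "exp (- F u $ 4) = 1 / E"
    "exp (2 * F u $ 4) = E ^ 2" "exp (- (2 * F u $ 4)) = 1 / E ^ 2" "exp (4 * F u $ 4) = E ^ 4"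
    by (rule that[of "exp (F u $ 4)"])
      (simp_all add: exp_minus inverse_eq_divide flip: exp_of_nat_mult)
  show ?thesis
    unfolding covariant_derivative_def \<nu>'_def[symmetric] F'_def[symmetric] sol_christoffel_eq
    using E(1) by (simp add: vec4_eq_iff \<omega>_def \<nu>_nth[OF assms] d1 d2 d3 d4 E field_simps power2_eq_square power4_eq_xxxx)
qed

text \<open>The form g(N, .) vanishes on tangent vectors, hence its pullback has zero exterior
  derivative. This expresses the symmetry of the second fundamental form.\<close>

lemma structure_equation:
  assumes "u \<in> V"
  shows "\<alpha>' u v * \<omega> u w $ 1 + \<beta>' u v * \<omega> u w $ 2 - \<alpha>' u w * \<omega> u v $ 1 - \<beta>' u w * \<omega> u v $ 2
    + 3 * c * (\<omega> u v $ 4 * \<omega> u w $ 3 - \<omega> u w $ 4 * \<omega> u v $ 3) = 0"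
proof -
  \<comment> \<open>The tangency relation for \<open>v\<close>, differentiated in direction
    \<open>w\<close>. Antisymmetrising in \<open>v\<close> and \<open>w\<close> will remove
    \<open>F''\<close>.\<close>
  have *: "\<alpha>' u w * \<omega> u v $ 1 + \<beta>' u w * \<omega> u v $ 2
      - \<omega> u w $ 4 * (\<alpha> u * \<omega> u v $ 1 + \<beta> u * \<omega> u v $ 2)
      + 2 * c * (\<omega> u w $ 4 * \<omega> u v $ 3)
      + exp (- F u $ 4) * (\<alpha> u * F'' u v w $ 1 + \<beta> u * F'' u v w $ 2)
      + c * exp (2 * F u $ 4) * F'' u v w $ 3 + d * F'' u v w $ 4 = 0" (is "?h v w = 0") for v w
  proof -
    have "((\<lambda>p. exp (- F p $ 4) * (\<alpha> p * F' p v $ 1 + \<beta> p * F' p v $ 2)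
        + c * exp (2 * F p $ 4) * F' p v $ 3 + d * F' p v $ 4) has_derivative ?h v) (at u)"
      using assms by (auto intro!: derivative_eq_intros F'_deriv simp: algebra_simps \<omega>_def)
    moreover have "((\<lambda>p. exp (- F p $ 4) * (\<alpha> p * F' p v $ 1 + \<beta> p * F' p v $ 2)
        + c * exp (2 * F p $ 4) * F' p v $ 3 + d * F' p v $ 4) has_derivative (\<lambda>_. 0)) (at u)"
      by (rule has_derivative_transform_within_open[OF has_derivative_const open_V assms])
        (use tangent_relation in \<open>simp add: \<omega>_def algebra_simps\<close>)
    ultimately have "?h v = (\<lambda>_. 0)"
      by (rule has_derivative_unique)
    then show ?thesis
      by (rule fun_cong)
  qed
  \<comment> \<open>This substitution raises the coefficient from 2c to 3c; the terms with
    \<open>d\<close> cancel by symmetry.\<close>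
  have normal: "\<alpha> u * \<omega> u v $ 1 + \<beta> u * \<omega> u v $ 2 = - c * \<omega> u v $ 3 - d * \<omega> u v $ 4" for v
    using tangent_relation[OF assms, of v] by simp
  show ?thesis
    using *[of v w] *[of w v] unfolding normal F''_commute[OF assms, of v w]
    by (simp add: algebra_simps)
qed

end

section \<open>Principal curvatures and first integrals of a patch\<close>

context sol_patch
begin

lemma principal_multiplicity_eq:
  assumes u: "u \<in> V"
    and eig: "covariant_derivative F \<nu> u v1 = - k1 *\<^sub>R F' u v1"
      "covariant_derivative F \<nu> u v2 = - k2 *\<^sub>R F' u v2"
      "covariant_derivative F \<nu> u v3 = - k3 *\<^sub>R F' u v3"
    and indep: "\<And>x y z. x *\<^sub>R \<omega> u v1 + y *\<^sub>R \<omega> u v2 + z *\<^sub>R \<omega> u v3 = 0 \<Longrightarrow> x = 0 \<and> y = 0 \<and> z = 0"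
  shows "principal_multiplicity F (\<lambda>p. \<epsilon> *\<^sub>R \<nu> p) u \<kappa> = count {#\<epsilon> * k1, \<epsilon> * k2, \<epsilon> * k3#} \<kappa>"
proof -
  define e :: "3 \<Rightarrow> real ^ 3" where "e i = (if i = 1 then v1 else if i = 2 then v2 else v3)" for i
  define k :: "real ^ 3" where "k = vector [k1, k2, k3]"
  have e: "e 1 = v1" "e 2 = v2" "e 3 = v3"
    by (simp_all add: e_def)
  have k: "k$1 = k1" "k$2 = k2" "k$3 = k3"
    by (simp_all add: k_def)
  have "principal_multiplicity F (\<lambda>p. \<epsilon> *\<^sub>R \<nu> p) u \<kappa> = count {#\<epsilon> * k$1, \<epsilon> * k$2, \<epsilon> * k$3#} \<kappa>"
  proof (rule principal_multiplicity_eq_count[where e = e])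
    show "F differentiable (at u)" "\<nu> differentiable (at u)"
      using F_deriv[OF u] \<nu>_deriv[OF u] by (auto simp: differentiable_def)
    show "inj (frechet_derivative F (at u))"
      by (rule inj_F'[OF u])
    show "covariant_derivative F \<nu> u (e i) = - k$i *\<^sub>R frechet_derivative F (at u) (e i)" for i
      using exhaust_3[of i] eig by (auto simp: e k F'_def)
    show "x = 0" if "x$1 *\<^sub>R e 1 + x$2 *\<^sub>R e 2 + x$3 *\<^sub>R e 3 = 0" for x :: "real ^ 3"
    proof -
      have "\<omega> u (x$1 *\<^sub>R v1 + x$2 *\<^sub>R v2 + x$3 *\<^sub>R v3) = 0"
        using that linear_0[OF linear_\<omega>[OF u]] by (simp add: e)
      then have "x$1 *\<^sub>R \<omega> u v1 + x$2 *\<^sub>R \<omega> u v2 + x$3 *\<^sub>R \<omega> u v3 = 0"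
        by (simp add: linear_add[OF linear_\<omega>[OF u]] linear_scale[OF linear_\<omega>[OF u]])
      from indep[OF this] show ?thesis by (simp add: vec3_eq_iff)
    qed
  qed
  then show ?thesis by (simp add: k)
qed

lemma covariant_derivative_eqI:
  assumes "u \<in> V"
    and "\<alpha>' u v - d * \<omega> u v $ 1 = - k * \<omega> u v $ 1"
    and "\<beta>' u v - d * \<omega> u v $ 2 = - k * \<omega> u v $ 2"
    and "2 * d * \<omega> u v $ 3 = - k * \<omega> u v $ 3"
    and "\<alpha> u * \<omega> u v $ 1 + \<beta> u * \<omega> u v $ 2 - 2 * c * \<omega> u v $ 3 = - k * \<omega> u v $ 4"
  shows "covariant_derivative F \<nu> u v = - k *\<^sub>R F' u v"
proof -
  have "sol_frame (F u) (- k *\<^sub>R F' u v) = - k *\<^sub>R \<omega> u v"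
    unfolding \<omega>_def by (rule linear_scale[OF linear_sol_frame])
  then have "sol_frame (F u) (covariant_derivative F \<nu> u v) = sol_frame (F u) (- k *\<^sub>R F' u v)"
    using assms(2-) unfolding frame_covariant_derivative[OF assms(1)] by (simp add: vec4_eq_iff del: sol_frame_nth)
  then show ?thesis by simp
qed

text \<open>Here \<alpha> and \<beta> vanish identically, and the tangent space is spanned by the
  principal directions E_1, E_2 and -d E_3 + c E_4.\<close>

lemma principal_multiplicity_horizontal:
  assumes "c\<^sup>2 + d\<^sup>2 = 1" and u: "u \<in> V"
  shows "principal_multiplicity F (\<lambda>p. \<epsilon> *\<^sub>R \<nu> p) u \<kappa> = count {#\<epsilon> * d, \<epsilon> * d, \<epsilon> * (- 2 * d)#} \<kappa>"
proof -
  have zero: "\<alpha> p = 0" "\<beta> p = 0" if "p \<in> V" for p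
    using \<alpha>\<beta>_unit[OF that] assms(1) sum_power2_eq_zero_iff[of "\<alpha> p" "\<beta> p"] by simp_all
  have "(\<alpha> has_derivative (\<lambda>_. 0)) (at u)" "(\<beta> has_derivative (\<lambda>_. 0)) (at u)"
    by (rule has_derivative_transform_within_open[OF has_derivative_const open_V u], simp add: zero)+
  then have deriv: "\<alpha>' u v = 0" "\<beta>' u v = 0" for v
    unfolding \<alpha>'_def \<beta>'_def by (simp_all add: frechet_derivative_eqI)
  obtain v1 where v1: "\<omega> u v1 = vector [1, 0, 0, 0]"
    by (atomize_elim, rule ex_tangent_vector[OF u]) (use zero u in auto)
  obtain v2 where v2: "\<omega> u v2 = vector [0, 1, 0, 0]"
    by (atomize_elim, rule ex_tangent_vector[OF u]) (use zero u in auto)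
  obtain v3 where v3: "\<omega> u v3 = vector [0, 0, - d, c]"
    by (atomize_elim, rule ex_tangent_vector[OF u]) (use zero u in auto)
  show ?thesis
  proof (rule principal_multiplicity_eq[OF u, of v1 d v2 d v3 "- 2 * d"])
    show "x = 0 \<and> y = 0 \<and> z = 0" if "x *\<^sub>R \<omega> u v1 + y *\<^sub>R \<omega> u v2 + z *\<^sub>R \<omega> u v3 = 0" for x y z
      using that assms(1) by (auto simp: v1 v2 v3 vec4_eq_iff)
  qed (rule covariant_derivative_eqI[OF u]; simp add: v1 v2 v3 deriv zero u)+
qed

text \<open>The structure equation is evaluated on two vectors whose xy-parts are multiples of
  (\<alpha>, \<beta>). The derivative terms vanish because (\<alpha>, \<beta>) has constant length,
  and only the term with factor \<open>c\<close> survives.\<close>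

lemma angle_E3_eq_0:
  assumes "c\<^sup>2 + d\<^sup>2 < 1" and u: "u \<in> V"
  shows "c = 0"
proof -
  define \<rho> where "\<rho> = 1 - c\<^sup>2 - d\<^sup>2"
  have \<rho>: "\<rho> > 0" "\<alpha> u * \<alpha> u + \<beta> u * \<beta> u = \<rho>"
    using assms(1) \<alpha>\<beta>_unit[OF u] by (simp_all add: \<rho>_def power2_eq_square)
  obtain v where v: "\<omega> u v = vector [- c * \<alpha> u, - c * \<beta> u, \<rho>, 0]"
    by (atomize_elim, rule ex_tangent_vector[OF u]) (simp add: algebra_simps flip: \<rho>(2))
  \<comment> \<open>Minus the tangential part of E_4, since \<rho> + c^2 = 1 - d^2.\<close>
  obtain w where w: "\<omega> u w = vector [d * \<alpha> u, d * \<beta> u, d * c, - (\<rho> + c * c)]"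
    by (atomize_elim, rule ex_tangent_vector[OF u]) (simp add: algebra_simps flip: \<rho>(2))
  have "3 * c * (\<rho> + c * c) * \<rho> = 0"
    using structure_equation[OF u, of v w] \<alpha>\<beta>_deriv_orthogonal[OF u, of v]
      \<alpha>\<beta>_deriv_orthogonal[OF u, of w]
    unfolding v w vector_4 by algebra
  moreover have "\<rho> + c * c > 0"
    using \<rho>(1) by (simp add: add_pos_nonneg)
  ultimately show ?thesis using \<rho>(1) by auto
qed

text \<open>The form \<open>\<theta>\<close> is dual to the principal direction \<open>- \<beta> E\<^sub>1 + \<alpha> E\<^sub>2\<close>.\<close>

definition \<theta> :: "real ^ 3 \<Rightarrow> real ^ 3 \<Rightarrow> real" where
  "\<theta> u v = - \<beta> u * \<omega> u v $ 1 + \<alpha> u * \<omega> u v $ 2"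

text \<open>As (\<alpha>, \<beta>) has constant length, its derivative is a multiple of (-\<beta>,
  \<alpha>); the structure equation for \<open>v\<close> and \<open>v1\<close> makes this multiple
  proportional to \<theta>. The rate \<open>m\<close> appears in the curvature of direction
  \<open>v1\<close>, which allows it to be compared between points.\<close>

lemma rotation_rate:
  assumes "d\<^sup>2 < 1" and c: "c = 0" and u: "u \<in> V"
  obtains m where "\<And>v. \<alpha>' u v = - m * \<beta> u * \<theta> u v" "\<And>v. \<beta>' u v = m * \<alpha> u * \<theta> u v"
    "\<And>\<epsilon> \<kappa>. principal_multiplicity F (\<lambda>p. \<epsilon> *\<^sub>R \<nu> p) u \<kappa>
      = count {#\<epsilon> * (d - m * (1 - d\<^sup>2)), \<epsilon> * d, \<epsilon> * (- 2 * d)#} \<kappa>"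
proof -
  define \<rho> where "\<rho> = 1 - d\<^sup>2"
  have \<rho>: "\<rho> > 0" "\<alpha> u * \<alpha> u + \<beta> u * \<beta> u = \<rho>"
    using assms \<alpha>\<beta>_unit[OF u] by (simp_all add: \<rho>_def power2_eq_square)
  obtain v1 where v1: "\<omega> u v1 = vector [- \<beta> u, \<alpha> u, 0, 0]"
    by (atomize_elim, rule ex_tangent_vector[OF u]) (use c in simp)
  obtain v2 where v2: "\<omega> u v2 = vector [\<alpha> u * d, \<beta> u * d, 0, - \<rho>]"
    by (atomize_elim, rule ex_tangent_vector[OF u]) (simp add: c algebra_simps flip: \<rho>(2))
  obtain v3 where v3: "\<omega> u v3 = vector [0, 0, 1, 0]"
    by (atomize_elim, rule ex_tangent_vector[OF u]) (use c in simp)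
  \<comment> \<open>Forced by the claim at \<open>v1\<close>, where both \<theta> and \<alpha>^2 +
    \<beta>^2 equal \<rho>.\<close>
  define m where "m = (\<alpha> u * \<beta>' u v1 - \<beta> u * \<alpha>' u v1) / \<rho>\<^sup>2"
  have m: "\<rho> * \<rho> * m = \<alpha> u * \<beta>' u v1 - \<beta> u * \<alpha>' u v1"
    using \<rho>(1) by (simp add: m_def power2_eq_square)
  have "\<rho> * \<rho> * (\<alpha>' u v + m * \<beta> u * \<theta> u v) = 0" "\<rho> * \<rho> * (\<beta>' u v - m * \<alpha> u * \<theta> u v) = 0" for v
    using structure_equation[OF u, of v v1] \<alpha>\<beta>_deriv_orthogonal[OF u, of v]
      \<alpha>\<beta>_deriv_orthogonal[OF u, of v1] m \<rho>(2)
    unfolding v1 vector_4 c \<theta>_def by algebra+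
  then have rot: "\<alpha>' u v = - m * \<beta> u * \<theta> u v" "\<beta>' u v = m * \<alpha> u * \<theta> u v" for v
    using \<rho>(1) by (simp_all add: add_eq_0_iff)
  have \<theta>: "\<theta> u v1 = \<rho>" "\<theta> u v2 = 0" "\<theta> u v3 = 0"
    unfolding \<theta>_def v1 v2 v3 using \<rho>(2) by (simp_all add: algebra_simps)
  have "principal_multiplicity F (\<lambda>p. \<epsilon> *\<^sub>R \<nu> p) u \<kappa>
      = count {#\<epsilon> * (d - m * \<rho>), \<epsilon> * d, \<epsilon> * (- 2 * d)#} \<kappa>" for \<epsilon> \<kappa>
  proof (rule principal_multiplicity_eq[OF u, of v1 _ v2 d v3 "- 2 * d"])
    show "covariant_derivative F \<nu> u v1 = - (d - m * \<rho>) *\<^sub>R F' u v1"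
      by (rule covariant_derivative_eqI[OF u])
        (simp_all add: rot[of v1] \<theta> v1 c algebra_simps)
    show "covariant_derivative F \<nu> u v2 = - d *\<^sub>R F' u v2"
      by (rule covariant_derivative_eqI[OF u])
        (simp_all add: rot[of v2] \<theta> v2 c algebra_simps flip: \<rho>(2))
    show "covariant_derivative F \<nu> u v3 = - (- 2 * d) *\<^sub>R F' u v3"
      by (rule covariant_derivative_eqI[OF u])
        (simp_all add: rot[of v3] \<theta> v3 c)
    show "x = 0 \<and> y = 0 \<and> z = 0" if "x *\<^sub>R \<omega> u v1 + y *\<^sub>R \<omega> u v2 + z *\<^sub>R \<omega> u v3 = 0" for x y z
      using that \<rho> by (auto simp: v1 v2 v3 vec4_eq_iff)
  qed
  from that[OF rot this[unfolded \<rho>_def]] show ?thesis .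
qed

text \<open>For constant \<open>m\<close> the forms d\<alpha> = -m \<beta> \<theta> and d\<beta> = m
  \<alpha> \<theta> are closed. Both are multiples of \<theta>, so what remains is \<beta> d\<theta>
  = 0 and \<alpha> d\<theta> = 0, and \<alpha>, \<beta> do not vanish together.\<close>

lemma rotation_rate_eq:
  assumes "d\<^sup>2 < 1" and c: "c = 0" and u: "u \<in> V" and "m \<noteq> 0"
    and rot: "\<And>p v. p \<in> V \<Longrightarrow> \<alpha>' p v = - m * \<beta> p * \<theta> p v" "\<And>p v. p \<in> V \<Longrightarrow> \<beta>' p v = m * \<alpha> p * \<theta> p v"
  shows "m * d = - 1"
proof -
  define \<rho> where "\<rho> = 1 - d\<^sup>2"
  have \<rho>: "\<rho> > 0" "\<alpha> u * \<alpha> u + \<beta> u * \<beta> u = \<rho>"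
    using assms(1) c \<alpha>\<beta>_unit[OF u] by (simp_all add: \<rho>_def power2_eq_square)
  obtain v where v: "\<omega> u v = vector [- \<beta> u, \<alpha> u, 0, 0]"
    by (atomize_elim, rule ex_tangent_vector[OF u]) (use c in simp)
  obtain w where w: "\<omega> u w = vector [\<alpha> u * d, \<beta> u * d, 0, - \<rho>]"
    by (atomize_elim, rule ex_tangent_vector[OF u]) (simp add: c algebra_simps flip: \<rho>(2))
  define \<theta>' where "\<theta>' v w = - \<omega> u w $ 4 * \<theta> u v - \<beta>' u w * \<omega> u v $ 1 + \<alpha>' u w * \<omega> u v $ 2
      + exp (- F u $ 4) * (- \<beta> u * F'' u v w $ 1 + \<alpha> u * F'' u v w $ 2)" for v w
  have \<theta>': "((\<lambda>p. \<theta> p v) has_derivative \<theta>' v) (at u)" for v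
    unfolding \<theta>_def \<omega>_def sol_frame_nth \<theta>'_def
    using u by (auto intro!: derivative_eq_intros F'_deriv simp: algebra_simps)
  have \<alpha>'': "((\<lambda>p. \<alpha>' p v) has_derivative (\<lambda>w. - m * (\<beta>' u w * \<theta> u v + \<beta> u * \<theta>' v w))) (at u)" for v
  proof (rule has_derivative_transform_within_open[OF _ open_V u])
    show "((\<lambda>p. - m * \<beta> p * \<theta> p v) has_derivative (\<lambda>w. - m * (\<beta>' u w * \<theta> u v + \<beta> u * \<theta>' v w))) (at u)"
      using u by (auto intro!: derivative_eq_intros \<theta>' simp: algebra_simps)
  qed (simp add: rot)
  have \<beta>'': "((\<lambda>p. \<beta>' p v) has_derivative (\<lambda>w. m * (\<alpha>' u w * \<theta> u v + \<alpha> u * \<theta>' v w))) (at u)" for v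
  proof (rule has_derivative_transform_within_open[OF _ open_V u])
    show "((\<lambda>p. m * \<alpha> p * \<theta> p v) has_derivative (\<lambda>w. m * (\<alpha>' u w * \<theta> u v + \<alpha> u * \<theta>' v w))) (at u)"
      using u by (auto intro!: derivative_eq_intros \<theta>' simp: algebra_simps)
  qed (simp add: rot)
  have \<theta>: "\<theta> u v = \<rho>" "\<theta> u w = 0"
    unfolding \<theta>_def v w using \<rho>(2) by (simp_all add: algebra_simps)
  \<comment> \<open>Up to sign this is d\<theta> on \<open>v\<close> and \<open>w\<close>; the
    second derivatives of \<open>F\<close> cancel by symmetry.\<close>
  have "\<theta>' v w - \<theta>' w v = \<rho> * \<rho> * (1 + m * d)"
    unfolding \<theta>'_def F''_commute[OF u, of w v] rot[OF u] \<theta> v w vector_4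
    by (simp add: algebra_simps flip: \<rho>(2))
  moreover have "\<beta> u * (\<theta>' v w - \<theta>' w v) = 0"
    using symmetric_second_derivative[OF open_V u \<alpha>_deriv \<alpha>''[of v] \<alpha>''[of w]] \<open>m \<noteq> 0\<close>
    by (simp add: rot[OF u] \<theta> algebra_simps)
  moreover have "\<alpha> u * (\<theta>' v w - \<theta>' w v) = 0"
    using symmetric_second_derivative[OF open_V u \<beta>_deriv \<beta>''[of v] \<beta>''[of w]] \<open>m \<noteq> 0\<close>
    by (simp add: rot[OF u] \<theta> algebra_simps)
  ultimately show ?thesis
    using \<rho> by (auto simp: add_eq_0_iff)
qed

text \<open>Here g(N, .) = c e^(2t) dz + d dt, and e^(-2t) is an integrating factor.\<close>

lemma first_integral_horizontal:
  assumes "\<And>p. p \<in> V \<Longrightarrow> \<alpha> p = 0" "\<And>p. p \<in> V \<Longrightarrow> \<beta> p = 0" and u: "u \<in> V"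
  shows "((\<lambda>p. c * F p $ 3 - d / 2 * exp (- 2 * F p $ 4)) has_derivative (\<lambda>_. 0)) (at u)"
proof -
  have "((\<lambda>p. c * F p $ 3 - d / 2 * exp (- 2 * F p $ 4)) has_derivative
      (\<lambda>v. exp (- 2 * F u $ 4) * (c * \<omega> u v $ 3 + d * \<omega> u v $ 4))) (at u)"
    using u by (auto intro!: derivative_eq_intros simp: \<omega>_def algebra_simps simp flip: exp_add)
  then show ?thesis
    using tangent_relation[OF u] assms by simp
qed

text \<open>With constant coefficients, e^t is an integrating factor of g(N, .).\<close>

lemma first_integral_flat:
  assumes c: "c = 0" and u: "u \<in> V"
    and const: "\<And>p. p \<in> V \<Longrightarrow> \<alpha> p = a" "\<And>p. p \<in> V \<Longrightarrow> \<beta> p = b"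
  shows "((\<lambda>p. a * F p $ 1 + b * F p $ 2 + d * exp (F p $ 4)) has_derivative (\<lambda>_. 0)) (at u)"
proof -
  have "((\<lambda>p. a * F p $ 1 + b * F p $ 2 + d * exp (F p $ 4)) has_derivative
      (\<lambda>v. exp (F u $ 4) * (a * \<omega> u v $ 1 + b * \<omega> u v $ 2 + d * \<omega> u v $ 4))) (at u)"
    using u by (auto intro!: derivative_eq_intros simp: \<omega>_def algebra_simps simp flip: exp_add)
  then show ?thesis
    using tangent_relation[OF u] c const[OF u] by simp
qed

text \<open>The two functions are the xy-coordinates of a point displaced from \<open>F\<close>
  along (\<alpha>, \<beta>). It stays fixed, and it is the centre of the circles in which the model
  meets the slices of constant t.\<close>

lemma first_integral_round:
  assumes "d\<^sup>2 < 1" and c: "c = 0" and u: "u \<in> V" and m: "m * d = - 1"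
    and rot: "\<And>v. \<alpha>' u v = - m * \<beta> u * \<theta> u v" "\<And>v. \<beta>' u v = m * \<alpha> u * \<theta> u v"
  shows "((\<lambda>p. F p $ 1 + d / (1 - d\<^sup>2) * exp (F p $ 4) * \<alpha> p) has_derivative (\<lambda>_. 0)) (at u)"
    and "((\<lambda>p. F p $ 2 + d / (1 - d\<^sup>2) * exp (F p $ 4) * \<beta> p) has_derivative (\<lambda>_. 0)) (at u)"
proof -
  define \<rho> where "\<rho> = 1 - d\<^sup>2"
  have \<rho>: "\<rho> > 0" "\<alpha> u * \<alpha> u + \<beta> u * \<beta> u = \<rho>"
    using assms(1) c \<alpha>\<beta>_unit[OF u] by (simp_all add: \<rho>_def power2_eq_square)
  \<comment> \<open>By \<open>m * d = - 1\<close>, \<open>d * \<alpha>'\<close> is \<beta> \<theta>;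
    with d \<omega>_4 taken from the tangency relation, the second summand becomes -(\<alpha>^2 +
    \<beta>^2) \<omega>_1. The other component is analogous.\<close>
  have "\<rho> * \<omega> u v $ 1 + d * (\<omega> u v $ 4 * \<alpha> u + \<alpha>' u v) = 0"
    "\<rho> * \<omega> u v $ 2 + d * (\<omega> u v $ 4 * \<beta> u + \<beta>' u v) = 0" for v
    using tangent_relation[OF u, of v] m \<rho>(2) unfolding rot \<theta>_def c by algebra+
  then have zero: "\<omega> u v $ 1 + d / \<rho> * (\<omega> u v $ 4 * \<alpha> u + \<alpha>' u v) = 0"
    "\<omega> u v $ 2 + d / \<rho> * (\<omega> u v $ 4 * \<beta> u + \<beta>' u v) = 0" for v
    using \<rho>(1) by (simp_all add: field_simps)
  have "((\<lambda>p. F p $ 1 + k * exp (F p $ 4) * \<alpha> p) has_derivative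
      (\<lambda>v. exp (F u $ 4) * (\<omega> u v $ 1 + k * (\<omega> u v $ 4 * \<alpha> u + \<alpha>' u v)))) (at u)"
    "((\<lambda>p. F p $ 2 + k * exp (F p $ 4) * \<beta> p) has_derivative
      (\<lambda>v. exp (F u $ 4) * (\<omega> u v $ 2 + k * (\<omega> u v $ 4 * \<beta> u + \<beta>' u v)))) (at u)" for k
    using u by (auto intro!: derivative_eq_intros simp: \<omega>_def algebra_simps simp flip: exp_add)
  from this[of "d / \<rho>"] show "((\<lambda>p. F p $ 1 + d / (1 - d\<^sup>2) * exp (F p $ 4) * \<alpha> p) has_derivative (\<lambda>_. 0)) (at u)"
    "((\<lambda>p. F p $ 2 + d / (1 - d\<^sup>2) * exp (F p $ 4) * \<beta> p) has_derivative (\<lambda>_. 0)) (at u)"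
    unfolding zero unfolding \<rho>_def by simp_all
qed

end

section \<open>Open parts of graphs\<close>

lemma chart_image_openin:
  assumes "smooth_manifold M \<A>" "(V, \<phi>) \<in> \<A>" "open U" "U \<subseteq> V"
  shows "openin M (\<phi> ` U)"
proof -
  have V: "openin M (\<phi> ` V)" "embedding_map (top_of_set V) M \<phi>"
    using assms(1,2) unfolding smooth_manifold_def by auto
  have "openin (top_of_set V) U"
    using assms(3,4) by (simp add: open_subset)
  then have "openin (subtopology M (\<phi> ` V)) (\<phi> ` U)"
    using V(2) homeomorphic_map_openness_eq unfolding embedding_map_def by fastforce
  then show ?thesis
    using V(1) by (simp add: openin_trans_full)
qed

text \<open>Every level set is open, because \<open>h\<close> is constant on balls in charts. The
  complement of a level set is a union of others, so each is clopen and connectedness leaves only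
  one.\<close>

lemma zero_derivative_constant_on_manifold:
  fixes h :: "'m \<Rightarrow> real"
  assumes M: "smooth_manifold M \<A>" and conn: "connected_space M"
    and deriv: "\<And>V \<phi> u. (V, \<phi>) \<in> \<A> \<Longrightarrow> u \<in> V \<Longrightarrow> ((\<lambda>u. h (\<phi> u)) has_derivative (\<lambda>_. 0)) (at u)"
  shows "h constant_on topspace M"
proof -
  define level where "level y = {p \<in> topspace M. h p = y}" for y
  have op: "openin M (level y)" for y
    unfolding openin_subopen[of M "level y"]
  proof
    fix p
    assume p: "p \<in> level y"
    then obtain V \<phi> u where V: "(V, \<phi>) \<in> \<A>" "u \<in> V" "p = \<phi> u"
      using M unfolding smooth_manifold_def level_def by blast
    then have "open V"
      using M unfolding smooth_manifold_def by blast
    then obtain r where r: "r > 0" "ball u r \<subseteq> V"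
      using V(2) open_contains_ball by blast
    have "\<exists>k. \<forall>x\<in>ball u r. h (\<phi> x) = k"
    proof (rule has_derivative_zero_constant)
      show "((\<lambda>x. h (\<phi> x)) has_derivative (\<lambda>_. 0)) (at x within ball u r)" if "x \<in> ball u r" for x
        using deriv[OF V(1)] r(2) that by (blast intro: has_derivative_at_withinI)
    qed simp
    then have "h (\<phi> x) = y" if "x \<in> ball u r" for x
      using that p V(3) r(1) unfolding level_def by (metis (mono_tags) centre_in_ball mem_Collect_eq)
    moreover have "openin M (\<phi> ` ball u r)"
      by (rule chart_image_openin[OF M V(1) open_ball r(2)])
    ultimately show "\<exists>T. openin M T \<and> p \<in> T \<and> T \<subseteq> level y"
      using V(3) r(1) openin_subset by (intro exI[of _ "\<phi> ` ball u r"]) (force simp: level_def)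
  qed
  show ?thesis
  proof (cases "topspace M = {}")
    case False
    then obtain p where p: "p \<in> topspace M" by blast
    have "topspace M - level (h p) = (\<Union>y\<in>- {h p}. level y)"
      by (auto simp: level_def)
    then have "closedin M (level (h p))"
      using op by (auto simp: closedin_def level_def)
    then have "level (h p) = topspace M"
      using op p conn unfolding connected_space_clopen_in level_def by blast
    then show ?thesis
      unfolding constant_on_def level_def by blast
  qed (simp add: constant_on_def)
qed

text \<open>An injective derivative in equal dimensions has a right inverse, which is what
  Sussmann's open mapping theorem asks for at each point.\<close>

lemma open_image_local_diffeomorphism:
  fixes h :: "'a::euclidean_space \<Rightarrow> 'a"
  assumes "open V" and deriv: "\<And>u. u \<in> V \<Longrightarrow> (h has_derivative h' u) (at u)"
    and inj: "\<And>u v. u \<in> V \<Longrightarrow> h' u v = 0 \<Longrightarrow> v = 0"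
  shows "open (h ` V)"
proof -
  have "h u \<in> interior (h ` V)" if u: "u \<in> V" for u
  proof -
    have lin: "linear (h' u)"
      using deriv[OF u] has_derivative_linear by blast
    have "inj (h' u)"
      using inj[OF u] linear_injective_0[OF lin] by blast
    then obtain g where "linear g" "h' u \<circ> g = id"
      using lin linear_injective_imp_surjective linear_surjective_right_inverse by blast
    moreover have "continuous_on V h"
      using deriv by (meson continuous_at_imp_continuous_on has_derivative_continuous)
    ultimately show ?thesis
      using sussmann_open_mapping[OF assms(1) _ u deriv[OF u], of g V] u assms(1)
      by (simp add: linear_conv_bounded_linear interior_open)
  qed
  then show ?thesis
    by (metis image_subset_iff interior_subset open_interior subset_antisym)
qed

text \<open>The models are graphs over coordinate hyperplanes; \<open>P\<close> is the projection to such a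
  hyperplane.\<close>

lemma open_part_graph:
  fixes P :: "real ^ 4 \<Rightarrow> real ^ 3"
  assumes hyp: "sol_hypersurface M \<A> f N"
    and P: "linear P" "inj_on P S" and L: "linear L"
    and \<Phi>: "\<And>p. \<Phi> p = q + L p"
    and im: "\<And>p. p \<in> topspace M \<Longrightarrow> \<Phi> (f p) \<in> S"
    and transversal: "\<And>p X. p \<in> topspace M \<Longrightarrow> sol_metric (f p) (N p) X = 0 \<Longrightarrow> P (L X) = 0 \<Longrightarrow> X = 0"
  shows "open_part (\<Phi> ` f ` topspace M) S"
proof -
  have "smooth_manifold M \<A>"
    using hyp by (simp add: sol_hypersurface_def)
  then have top: "(\<Union>(V, \<phi>)\<in>\<A>. \<phi> ` V) = topspace M"
    and V: "\<And>V \<phi>. (V, \<phi>) \<in> \<A> \<Longrightarrow> open V"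
    by (auto simp: smooth_manifold_def)
  \<comment> \<open>Transversality says that the tangent space meets the kernel of
    \<open>P \<circ> L\<close> only in 0, so this map between spaces of dimension 3 has injective
    derivative.\<close>
  have "open ((\<lambda>u. P (\<Phi> (f (\<phi> u)))) ` V)" if "(V, \<phi>) \<in> \<A>" for V \<phi>
  proof (rule open_image_local_diffeomorphism)
    show "open V" using V that .
    fix u assume "u \<in> V"
    define D where "D = frechet_derivative (f \<circ> \<phi>) (at u)"
    have fu: "\<phi> u \<in> topspace M"
      using top that \<open>u \<in> V\<close> by blast
    have "smooth_map_on (f \<circ> \<phi>) V" "inj D"
      and normal: "\<And>v. sol_metric (f (\<phi> u)) (N (\<phi> u)) (D v) = 0"
      using hyp that \<open>u \<in> V\<close> unfolding sol_hypersurface_def D_def by blast+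
    then have D: "((f \<circ> \<phi>) has_derivative D) (at u)"
      using \<open>u \<in> V\<close> unfolding smooth_map_on_def D_def
      by (metis One_nat_def frechet_derivative_works times_differentiable_on.simps(2))
    have "bounded_linear (P \<circ> L)"
      using P(1) L linear_compose linear_conv_bounded_linear by blast
    from bounded_linear.has_derivative[OF this D]
    show "((\<lambda>u. P (\<Phi> (f (\<phi> u)))) has_derivative (\<lambda>v. P (L (frechet_derivative (f \<circ> \<phi>) (at u) v)))) (at u)"
      using has_derivative_add[OF has_derivative_const[of "P q"]]
      by (fastforce simp: \<Phi> linear_add[OF P(1)] o_def D_def)
    show "v = 0" if "P (L (frechet_derivative (f \<circ> \<phi>) (at u) v)) = 0" for v
    proof -
      have "D v = 0"
        using transversal[OF fu normal] that unfolding D_def by blast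
      then show ?thesis
        using \<open>inj D\<close> linear_0[OF has_derivative_linear[OF D]] by (metis injD)
    qed
  qed
  then have "open (\<Union>(V, \<phi>)\<in>\<A>. (\<lambda>u. P (\<Phi> (f (\<phi> u)))) ` V)"
    by (intro open_UN) auto
  also have "(\<Union>(V, \<phi>)\<in>\<A>. (\<lambda>u. P (\<Phi> (f (\<phi> u)))) ` V) = P ` \<Phi> ` f ` topspace M"
    unfolding top[symmetric] by (simp add: image_UN image_image split_def)
  finally have "open (P -` (P ` \<Phi> ` f ` topspace M))"
    using P(1) by (intro open_vimage linear_continuous_on) (auto simp: linear_conv_bounded_linear)
  \<comment> \<open>Injectivity of \<open>P\<close> on \<open>S\<close> recovers the image from its
    open projection.\<close>
  moreover have "\<Phi> ` f ` topspace M = S \<inter> P -` (P ` \<Phi> ` f ` topspace M)"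
    using P(2) im by (auto simp: inj_on_def)
  ultimately show ?thesis
    unfolding open_part_def openin_open by blast
qed

text \<open>In coordinates an isometry is affine; this is its linear part. \<open>C\<close> and
  \<open>S\<close> are cosine and sine of a rotation of the xy-plane, \<sigma> is the reflection of
  z, and \<open>s\<close> is the t-coordinate of the translating element, which rescales x, y and
  z.\<close>

definition sol_motion_linear :: "real \<Rightarrow> real \<Rightarrow> real \<Rightarrow> real \<Rightarrow> real ^ 4 \<Rightarrow> real ^ 4" where
  "sol_motion_linear s C S \<sigma> p = vector [exp s * (C * p$1 - S * p$2), exp s * (S * p$1 + C * p$2),
     exp (- 2 * s) * (\<sigma> * p$3), p$4]"

lemma sol_motion_linear_nth [simp]:
  "sol_motion_linear s C S \<sigma> p $ 1 = exp s * (C * p$1 - S * p$2)"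
  "sol_motion_linear s C S \<sigma> p $ 2 = exp s * (S * p$1 + C * p$2)"
  "sol_motion_linear s C S \<sigma> p $ 3 = exp (- 2 * s) * (\<sigma> * p$3)"
  "sol_motion_linear s C S \<sigma> p $ 4 = p$4"
  by (simp_all add: sol_motion_linear_def)

lemma linear_sol_motion_linear: "linear (sol_motion_linear s C S \<sigma>)"
  by (auto intro!: linearI simp: vec4_eq_iff algebra_simps)

lemma sol_motion_in_sol_isometries:
  assumes "C\<^sup>2 + S\<^sup>2 = 1" "\<sigma> \<in> {1, - 1}"
  shows "(\<lambda>p. q + sol_motion_linear (q$4) C S \<sigma> p) \<in> sol_isometries"
proof -
  define Q :: "real ^ 2 ^ 2" where "Q = vector [vector [C, - S], vector [S, C]]"
  have "orthogonal_matrix Q"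
    unfolding orthogonal_matrix
    using assms(1) by (simp add: Q_def vec_eq_iff forall_2 matrix_matrix_mult_def transpose_def
        sum_2 mat_def power2_eq_square)
  moreover have "(\<lambda>p. q + sol_motion_linear (q$4) C S \<sigma> p) = (\<lambda>p. sol_mult q
      (vector [(Q *v vector [p$1, p$2])$1, (Q *v vector [p$1, p$2])$2, \<sigma> * p$3, p$4]))"
    by (simp add: fun_eq_iff vec4_eq_iff sol_mult_def Q_def matrix_vector_mult_def sum_2)
  ultimately show ?thesis
    unfolding sol_isometries_def using assms(2) by blast
qed

section \<open>The classification\<close>

lemma tanh_artanh_real: "\<bar>x\<bar> < 1 \<Longrightarrow> tanh (artanh x) = x" for x :: real
proof -
  assume x: "\<bar>x\<bar> < 1"
  then have exp: "exp (- 2 * artanh x) = (1 - x) / (1 + x)"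
    by (simp add: artanh_def exp_minus)
  show ?thesis
    using x unfolding tanh_real_altdef exp by (simp add: field_simps)
qed

text \<open>The curvatures determine \<open>tanh r\<close>, whereas the implicit equations of the
  models contain \<open>sinh r\<close>.\<close>

lemma sinh_artanh_real: "\<bar>x\<bar> < 1 \<Longrightarrow> sinh (artanh x) = x / sqrt (1 - x\<^sup>2)" for x :: real
proof -
  assume x: "\<bar>x\<bar> < 1"
  have *: "sinh (artanh x) = x * cosh (artanh x)"
    using tanh_artanh_real[OF x] by (simp add: tanh_def field_simps)
  have "(cosh (artanh x))\<^sup>2 * (1 - x\<^sup>2) = 1"
    using cosh_square_eq[of "artanh x"] unfolding * by (simp add: algebra_simps)
  then have "cosh (artanh x) * sqrt (1 - x\<^sup>2) = 1"
    by (metis cosh_real_nonneg real_sqrt_mult real_sqrt_one real_sqrt_unique)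
  then show ?thesis
    unfolding * by (metis div_by_1 mult_eq_0_iff nonzero_mult_div_cancel_right times_divide_eq_right zero_neq_one)
qed

lemma artanh_real_nonneg: "0 \<le> x \<Longrightarrow> x < 1 \<Longrightarrow> 0 \<le> artanh x" for x :: real
  using tanh_artanh_real[of x] tanh_real_nonneg_iff[of "artanh x"] by simp

lemma artanh_real_pos: "0 < x \<Longrightarrow> x < 1 \<Longrightarrow> 0 < artanh x" for x :: real
  using tanh_artanh_real[of x] tanh_real_pos_iff[of "artanh x"] by simp

section \<open>Implicit equations of the models\<close>

lemma exp_diff_ln_sech: "exp (t - ln (sech r)) * tanh r = exp t * sinh r"
  by (simp add: sech_def exp_diff tanh_def)

text \<open>In each slice of constant t the model is a circle of radius e^t sinh r in xy, times the
  z-line, and \<open>x1\<close> is the polar angle. For \<open>r > 0\<close> this radius is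
  positive, so it can be divided out to find the angle.\<close>

lemma sol_M1_eq:
  assumes "r > 0"
  shows "sol_M1 r = {p. (p$1)\<^sup>2 + (p$2)\<^sup>2 = (exp (p$4) * sinh r)\<^sup>2}"
proof (intro set_eqI iffI)
  fix p
  assume "p \<in> sol_M1 r"
  then obtain x1 x2 x3 where p: "p = vector [exp x3 * cos x1 * tanh r, exp x3 * sin x1 * tanh r, x2,
      x3 + ln (sech r)]"
    unfolding sol_M1_def by blast
  have "exp x3 * tanh r = exp (p$4) * sinh r"
    using exp_diff_ln_sech[of "p$4" r] by (simp add: p)
  moreover have "(p$1)\<^sup>2 + (p$2)\<^sup>2 = (exp x3 * tanh r)\<^sup>2 * ((cos x1)\<^sup>2 + (sin x1)\<^sup>2)"
    by (simp add: p power_mult_distrib algebra_simps del: sin_cos_squared_add sin_cos_squared_add2)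
  ultimately show "p \<in> {p. (p$1)\<^sup>2 + (p$2)\<^sup>2 = (exp (p$4) * sinh r)\<^sup>2}"
    by simp
next
  fix p :: "real ^ 4"
  define R where "R = exp (p$4) * sinh r"
  assume "p \<in> {p. (p$1)\<^sup>2 + (p$2)\<^sup>2 = (exp (p$4) * sinh r)\<^sup>2}"
  then have p: "(p$1)\<^sup>2 + (p$2)\<^sup>2 = R\<^sup>2"
    by (simp add: R_def)
  have "R > 0"
    using assms by (simp add: R_def)
  then have "(p$1 / R)\<^sup>2 + (p$2 / R)\<^sup>2 = 1"
    using p by (simp add: power_divide flip: add_divide_distrib)
  then obtain x where "p$1 / R = cos x" "p$2 / R = sin x"
    using sincos_total_2pi by metis
  then have "p$1 = R * cos x" "p$2 = R * sin x"
    using \<open>R > 0\<close> by (simp_all add: field_simps)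
  then have "p = vector [exp (p$4 - ln (sech r)) * cos x * tanh r,
      exp (p$4 - ln (sech r)) * sin x * tanh r, p$3, (p$4 - ln (sech r)) + ln (sech r)]"
    using exp_diff_ln_sech[of "p$4" r] by (simp add: vec4_eq_iff R_def algebra_simps)
  then show "p \<in> sol_M1 r"
    unfolding sol_M1_def by blast
qed

lemma sol_M2_eq: "sol_M2 r = {p. p$2 = exp (p$4) * sinh r}"
proof (intro set_eqI iffI)
  fix p
  assume "p \<in> sol_M2 r"
  then show "p \<in> {p. p$2 = exp (p$4) * sinh r}"
    using exp_diff_ln_sech[of "p$4" r] unfolding sol_M2_def by auto
next
  fix p
  assume "p \<in> {p :: real ^ 4. p$2 = exp (p$4) * sinh r}"
  then have "p = vector [p$1, exp (p$4 - ln (sech r)) * tanh r, p$3, (p$4 - ln (sech r)) + ln (sech r)]"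
    using exp_diff_ln_sech[of "p$4" r] by (simp add: vec4_eq_iff)
  then show "p \<in> sol_M2 r"
    unfolding sol_M2_def by blast
qed

lemma sol_M3_eq: "sol_M3 r = {p. p$3 = exp (- 2 * p$4) * sinh (2 * r) / 2}"
proof (intro set_eqI iffI)
  have *: "exp (- 2 * (t - ln (cosh (2 * r)) / 2)) * tanh (2 * r) = exp (- 2 * t) * sinh (2 * r)" for t
  proof -
    have "- 2 * (t - ln (cosh (2 * r)) / 2) = - 2 * t + ln (cosh (2 * r))"
      by simp
    then show ?thesis
      by (simp only: exp_add exp_ln cosh_real_pos) (simp add: tanh_def)
  qed
  {
    fix p
    assume "p \<in> sol_M3 r"
    then show "p \<in> {p. p$3 = exp (- 2 * p$4) * sinh (2 * r) / 2}"
      using *[of "p$4"] unfolding sol_M3_def by auto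
  }
  fix p
  assume "p \<in> {p :: real ^ 4. p$3 = exp (- 2 * p$4) * sinh (2 * r) / 2}"
  then have "p = vector [p$1, p$2, 1 / 2 * exp (- 2 * (p$4 - ln (cosh (2 * r)) / 2)) * tanh (2 * r),
      (p$4 - ln (cosh (2 * r)) / 2) + 1 / 2 * ln (cosh (2 * r))]"
    using *[of "p$4"] by (simp add: vec4_eq_iff)
  then show "p \<in> sol_M3 r"
    unfolding sol_M3_def by blast
qed

lemma sol_M4_0_eq: "sol_M4_0 = {p. p$4 = 0}"
proof (intro set_eqI iffI)
  show "p \<in> sol_M4_0" if "p \<in> {p. p$4 = 0}" for p
  proof -
    have "p = vector [p$1, p$2, p$3, 0]"
      using that by (simp add: vec4_eq_iff)
    then show ?thesis
      unfolding sol_M4_0_def by blast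
  qed
qed (auto simp: sol_M4_0_def)

section \<open>From charts to the whole hypersurface\<close>

locale constant_angle_hypersurface =
  fixes M :: "'m topology" and \<A> :: "(real ^ 3, 'm) atlas" and f N :: "'m \<Rightarrow> real ^ 4"
    and c d :: real
  assumes hypersurface: "sol_hypersurface M \<A> f N"
    and connected: "connected_space M"
    and nonempty: "topspace M \<noteq> {}"
    and angle_E3: "p \<in> topspace M \<Longrightarrow> angle_function f N sol_E3 p = c"
    and angle_E4: "p \<in> topspace M \<Longrightarrow> angle_function f N sol_E4 p = d"
begin

text \<open>The remaining two angle functions live on \<open>M\<close> itself and pull back to
  \<alpha> and \<beta> in every chart, which joins the results of different charts.\<close>

definition a :: "'m \<Rightarrow> real" where "a p = sol_frame (f p) (N p) $ 1"
definition b :: "'m \<Rightarrow> real" where "b p = sol_frame (f p) (N p) $ 2"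

lemma manifold: "smooth_manifold M \<A>"
  using hypersurface by (simp add: sol_hypersurface_def)

lemma chart_in_topspace: "(V, \<phi>) \<in> \<A> \<Longrightarrow> u \<in> V \<Longrightarrow> \<phi> u \<in> topspace M"
  using manifold unfolding smooth_manifold_def by blast

lemma ex_chart: "p \<in> topspace M \<Longrightarrow> \<exists>V \<phi> u. (V, \<phi>) \<in> \<A> \<and> u \<in> V \<and> p = \<phi> u"
  using manifold unfolding smooth_manifold_def by blast

lemma patch: "(V, \<phi>) \<in> \<A> \<Longrightarrow> sol_patch V (f \<circ> \<phi>) (N \<circ> \<phi>) c d"
proof
  assume V: "(V, \<phi>) \<in> \<A>"
  show "open V"
    using V manifold unfolding smooth_manifold_def by blast
  show "smooth_map_on (f \<circ> \<phi>) V" "smooth_map_on (N \<circ> \<phi>) V"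
    using V hypersurface unfolding sol_hypersurface_def by blast+
  fix u
  assume u: "u \<in> V"
  show "inj (frechet_derivative (f \<circ> \<phi>) (at u))"
    "sol_metric ((f \<circ> \<phi>) u) ((N \<circ> \<phi>) u) (frechet_derivative (f \<circ> \<phi>) (at u) v) = 0"
    "sol_metric ((f \<circ> \<phi>) u) ((N \<circ> \<phi>) u) ((N \<circ> \<phi>) u) = 1" for v
    using V u hypersurface unfolding sol_hypersurface_def o_apply by blast+
  show "sol_metric ((f \<circ> \<phi>) u) ((N \<circ> \<phi>) u) (sol_E3 ((f \<circ> \<phi>) u)) = c"
    "sol_metric ((f \<circ> \<phi>) u) ((N \<circ> \<phi>) u) (sol_E4 ((f \<circ> \<phi>) u)) = d"
    using angle_E3 angle_E4 chart_in_topspace[OF V u] by (simp_all add: angle_function_def)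
qed

lemma patch_\<alpha>: "(V, \<phi>) \<in> \<A> \<Longrightarrow> sol_patch.\<alpha> (f \<circ> \<phi>) (N \<circ> \<phi>) = (\<lambda>u. a (\<phi> u))"
  and patch_\<beta>: "(V, \<phi>) \<in> \<A> \<Longrightarrow> sol_patch.\<beta> (f \<circ> \<phi>) (N \<circ> \<phi>) = (\<lambda>u. b (\<phi> u))"
  using sol_patch.\<alpha>_def[OF patch] sol_patch.\<beta>_def[OF patch] by (simp_all add: fun_eq_iff a_def b_def)

lemma ab_unit: "p \<in> topspace M \<Longrightarrow> (a p)\<^sup>2 + (b p)\<^sup>2 = 1 - c\<^sup>2 - d\<^sup>2"
  using ex_chart sol_patch.\<alpha>\<beta>_unit[OF patch] by (metis patch_\<alpha> patch_\<beta>)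

lemma metric_N:
  assumes "p \<in> topspace M"
  shows "sol_metric (f p) (N p) X = exp (- f p $ 4) * (a p * X$1 + b p * X$2)
    + exp (2 * f p $ 4) * c * X$3 + d * X$4"
proof -
  obtain V \<phi> u where V: "(V, \<phi>) \<in> \<A>" "u \<in> V" "p = \<phi> u"
    using ex_chart[OF assms] by blast
  have "sol_frame (f p) (N p) = vector [a p, b p, c, d]"
    using sol_patch.frame_\<nu>[OF patch[OF V(1)] V(2)] by (simp add: patch_\<alpha>[OF V(1)] patch_\<beta>[OF V(1)] V(3))
  then show ?thesis
    by (simp add: sol_metric_eq_inner_frame inner_vec4 algebra_simps)
qed

lemma has_principal_curvaturesI:
  assumes "\<And>V \<phi> u \<kappa>. (V, \<phi>) \<in> \<A> \<Longrightarrow> u \<in> V \<Longrightarrow>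
    principal_multiplicity (f \<circ> \<phi>) (\<lambda>p. \<epsilon> *\<^sub>R (N \<circ> \<phi>) p) u \<kappa> = count C \<kappa>"
  shows "has_principal_curvatures \<A> f (\<lambda>p. \<epsilon> *\<^sub>R N p) C"
  using assms unfolding has_principal_curvatures_def by (auto simp: o_def)

lemma constant_onE:
  fixes h :: "'m \<Rightarrow> real"
  assumes "\<And>V \<phi> u. (V, \<phi>) \<in> \<A> \<Longrightarrow> u \<in> V \<Longrightarrow> ((\<lambda>u. h (\<phi> u)) has_derivative (\<lambda>_. 0)) (at u)"
  obtains k where "\<And>p. p \<in> topspace M \<Longrightarrow> h p = k"
  using zero_derivative_constant_on_manifold[OF manifold connected, of h] assms
  unfolding constant_on_def by blast

text \<open>For \<open>c \<noteq> 0\<close> the first integral exhibits z as a function of t, and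
  for \<open>c = 0\<close> it fixes t.\<close>

lemma horizontal_case:
  assumes unit: "c\<^sup>2 + d\<^sup>2 = 1" and \<epsilon>: "\<epsilon> * d = \<bar>d\<bar>"
  shows "\<exists>\<Phi>\<in>sol_isometries.
    (\<exists>r\<ge>0. open_part (\<Phi> ` f ` topspace M) (sol_M3 r) \<and>
       has_principal_curvatures \<A> f (\<lambda>p. \<epsilon> *\<^sub>R N p) {#tanh (2 * r), tanh (2 * r), - 2 * tanh (2 * r)#}) \<or>
    (open_part (\<Phi> ` f ` topspace M) sol_M4_0 \<and>
       has_principal_curvatures \<A> f (\<lambda>p. \<epsilon> *\<^sub>R N p) {#1, 1, - 2#})"
proof -
  have zero: "a p = 0" "b p = 0" if "p \<in> topspace M" for p
    using ab_unit[OF that] unit sum_power2_eq_zero_iff[of "a p" "b p"] by simp_all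
  have curv: "has_principal_curvatures \<A> f (\<lambda>p. \<epsilon> *\<^sub>R N p) {#\<bar>d\<bar>, \<bar>d\<bar>, - 2 * \<bar>d\<bar>#}"
  proof (rule has_principal_curvaturesI)
    show "principal_multiplicity (f \<circ> \<phi>) (\<lambda>p. \<epsilon> *\<^sub>R (N \<circ> \<phi>) p) u \<kappa> = count {#\<bar>d\<bar>, \<bar>d\<bar>, - 2 * \<bar>d\<bar>#} \<kappa>"
      if "(V, \<phi>) \<in> \<A>" "u \<in> V" for V \<phi> u \<kappa>
      using sol_patch.principal_multiplicity_horizontal[OF patch[OF that(1)] unit that(2), of \<epsilon> \<kappa>]
      by (simp flip: \<epsilon>)
  qed
  obtain k where k: "\<And>p. p \<in> topspace M \<Longrightarrow> c * f p $ 3 - d / 2 * exp (- 2 * f p $ 4) = k"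
  proof (rule constant_onE)
    fix V \<phi> u
    assume V: "(V, \<phi>) \<in> \<A>" "u \<in> V"
    show "((\<lambda>u. c * f (\<phi> u) $ 3 - d / 2 * exp (- 2 * f (\<phi> u) $ 4)) has_derivative (\<lambda>_. 0)) (at u)"
      using sol_patch.first_integral_horizontal[OF patch[OF V(1)] _ _ V(2)]
        zero chart_in_topspace[OF V(1)] by (simp add: patch_\<alpha>[OF V(1)] patch_\<beta>[OF V(1)])
  qed blast
  show ?thesis
  proof (cases "c = 0")
    case False
    then have "d\<^sup>2 < 1" "sqrt (1 - \<bar>d\<bar>\<^sup>2) = \<bar>c\<bar>"
      using unit by (auto simp flip: unit)
    then have d: "\<bar>d\<bar> < 1"
      by (simp add: abs_square_less_1)
    \<comment> \<open>Chosen so that tanh (2r) is the curvature |d|; then sinh (2r) = |d| / |c|,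
      because |c| = sqrt (1 - d^2).\<close>
    define r where "r = artanh \<bar>d\<bar> / 2"
    have r: "r \<ge> 0" "tanh (2 * r) = \<bar>d\<bar>" "sinh (2 * r) = \<bar>d\<bar> / \<bar>c\<bar>"
      using d artanh_real_nonneg[of "\<bar>d\<bar>"] tanh_artanh_real[of "\<bar>d\<bar>"] sinh_artanh_real[of "\<bar>d\<bar>"]
        \<open>sqrt (1 - \<bar>d\<bar>\<^sup>2) = \<bar>c\<bar>\<close> by (auto simp: r_def)
    \<comment> \<open>The reflection of z makes the coefficient of e^(-2t) nonnegative.\<close>
    obtain \<sigma> where \<sigma>: "\<sigma> \<in> {1, - 1}" "\<sigma> * (d / c) = \<bar>d\<bar> / \<bar>c\<bar>"
    proof (cases "d / c \<ge> 0")
      case True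
      then show ?thesis using that[of 1] by (simp flip: abs_divide)
    next
      case False
      then show ?thesis using that[of "- 1"] by (simp flip: abs_divide)
    qed
    \<comment> \<open>Translation in z absorbs the constant of the first integral; the t-part is 0,
      so nothing is rescaled.\<close>
    define q :: "real ^ 4" where "q = vector [0, 0, - \<sigma> * (k / c), 0]"
    define \<Phi> where "\<Phi> p = q + sol_motion_linear (q$4) 1 0 \<sigma> p" for p
    define P :: "real ^ 4 \<Rightarrow> real ^ 3" where "P p = vector [p$1, p$2, p$4]" for p
    have "\<Phi> \<in> sol_isometries"
      unfolding \<Phi>_def[abs_def] using \<sigma>(1) by (intro sol_motion_in_sol_isometries) auto
    moreover have "open_part (\<Phi> ` f ` topspace M) (sol_M3 r)"
    proof (rule open_part_graph[OF hypersurface _ _ linear_sol_motion_linear \<Phi>_def])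
      show "linear P"
        by (auto intro!: linearI simp: P_def vec3_eq_iff)
      show "inj_on P (sol_M3 r)"
        by (auto simp: inj_on_def P_def vec3_eq_iff vec4_eq_iff sol_M3_eq)
      show "\<Phi> (f p) \<in> sol_M3 r" if "p \<in> topspace M" for p
      proof -
        have "f p $ 3 = k / c + d / c * exp (- 2 * f p $ 4) / 2"
          using k[OF that] False by (simp add: field_simps)
        then show ?thesis
          unfolding sol_M3_eq r \<sigma>(2)[symmetric] by (simp add: \<Phi>_def q_def algebra_simps)
      qed
      show "X = 0" if "p \<in> topspace M" "sol_metric (f p) (N p) X = 0"
        "P (sol_motion_linear (q$4) 1 0 \<sigma> X) = 0" for p X
        using that(2,3) False unfolding metric_N[OF that(1)] by (simp add: P_def vec3_eq_iff vec4_eq_iff)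
    qed
    ultimately show ?thesis
      using curv r by metis
  next
    case True
    then have "\<bar>d\<bar> = 1"
      using unit by (auto simp: power2_eq_1_iff)
    \<comment> \<open>The first integral reduces to -(d/2) e^(-2t) = k, and 1/d = d.\<close>
    then have exp: "exp (- 2 * f p $ 4) = - 2 * d * k" if "p \<in> topspace M" for p
      using k[OF that] True by (auto simp: abs_if split: if_splits)
    obtain p0 where p0: "p0 \<in> topspace M"
      using nonempty by blast
    define t where "t = f p0 $ 4"
    have t: "f p $ 4 = t" if "p \<in> topspace M" for p
    proof -
      have "exp (- 2 * f p $ 4) = exp (- 2 * t)"
        unfolding t_def exp[OF that] exp[OF p0] ..
      then show ?thesis by simp
    qed
    define q :: "real ^ 4" where "q = vector [0, 0, 0, - t]"
    define \<Phi> where "\<Phi> p = q + sol_motion_linear (q$4) 1 0 1 p" for p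
    define P :: "real ^ 4 \<Rightarrow> real ^ 3" where "P p = vector [p$1, p$2, p$3]" for p
    have "\<Phi> \<in> sol_isometries"
      unfolding \<Phi>_def[abs_def] by (intro sol_motion_in_sol_isometries) auto
    moreover have "open_part (\<Phi> ` f ` topspace M) sol_M4_0"
    proof (rule open_part_graph[OF hypersurface _ _ linear_sol_motion_linear \<Phi>_def])
      show "linear P"
        by (auto intro!: linearI simp: P_def vec3_eq_iff)
      show "inj_on P sol_M4_0"
        by (auto simp: inj_on_def P_def vec3_eq_iff vec4_eq_iff sol_M4_0_eq)
      show "\<Phi> (f p) \<in> sol_M4_0" if "p \<in> topspace M" for p
        using t[OF that] by (simp add: sol_M4_0_eq \<Phi>_def q_def)
      show "X = 0" if "p \<in> topspace M" "sol_metric (f p) (N p) X = 0"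
        "P (sol_motion_linear (q$4) 1 0 1 X) = 0" for p X
        using that(2,3) \<open>\<bar>d\<bar> = 1\<close> unfolding metric_N[OF that(1)]
        by (auto simp: P_def vec3_eq_iff vec4_eq_iff)
    qed
    ultimately show ?thesis
      using curv \<open>\<bar>d\<bar> = 1\<close> by auto
  qed
qed

text \<open>Rotation rates are first found point by point. Constant principal curvatures make them
  equal everywhere, also across charts.\<close>

lemma ex_rotation_rate:
  assumes const: "constant_principal_curvatures \<A> f N" and d: "d\<^sup>2 < 1" and c: "c = 0"
  obtains m where "\<And>V \<phi> u v. (V, \<phi>) \<in> \<A> \<Longrightarrow> u \<in> V \<Longrightarrow> sol_patch.\<alpha>' (f \<circ> \<phi>) (N \<circ> \<phi>) u v
      = - m * b (\<phi> u) * sol_patch.\<theta> (f \<circ> \<phi>) (N \<circ> \<phi>) u v"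
    "\<And>V \<phi> u v. (V, \<phi>) \<in> \<A> \<Longrightarrow> u \<in> V \<Longrightarrow> sol_patch.\<beta>' (f \<circ> \<phi>) (N \<circ> \<phi>) u v
      = m * a (\<phi> u) * sol_patch.\<theta> (f \<circ> \<phi>) (N \<circ> \<phi>) u v"
    "\<And>\<epsilon>. has_principal_curvatures \<A> f (\<lambda>p. \<epsilon> *\<^sub>R N p)
      {#\<epsilon> * (d - m * (1 - d\<^sup>2)), \<epsilon> * d, \<epsilon> * (- 2 * d)#}"
proof -
  define rate where "rate V \<phi> u m \<longleftrightarrow>
      (\<forall>v. sol_patch.\<alpha>' (f \<circ> \<phi>) (N \<circ> \<phi>) u v = - m * b (\<phi> u) * sol_patch.\<theta> (f \<circ> \<phi>) (N \<circ> \<phi>) u v) \<and>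
      (\<forall>v. sol_patch.\<beta>' (f \<circ> \<phi>) (N \<circ> \<phi>) u v = m * a (\<phi> u) * sol_patch.\<theta> (f \<circ> \<phi>) (N \<circ> \<phi>) u v) \<and>
      (\<forall>\<epsilon> \<kappa>. principal_multiplicity (f \<circ> \<phi>) (\<lambda>p. \<epsilon> *\<^sub>R (N \<circ> \<phi>) p) u \<kappa>
        = count {#\<epsilon> * (d - m * (1 - d\<^sup>2)), \<epsilon> * d, \<epsilon> * (- 2 * d)#} \<kappa>)"
    for V :: "(real ^ 3) set" and \<phi> u m
  have ex: "\<exists>m. rate V \<phi> u m" if V: "(V, \<phi>) \<in> \<A>" "u \<in> V" for V \<phi> u
    using sol_patch.rotation_rate[OF patch[OF V(1)] d c V(2)]
    unfolding rate_def patch_\<alpha>[OF V(1)] patch_\<beta>[OF V(1)] by metis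
  have unique: "m = m'" if "(V, \<phi>) \<in> \<A>" "u \<in> V" "rate V \<phi> u m" "(W, \<psi>) \<in> \<A>" "w \<in> W" "rate W \<psi> w m'"
    for V \<phi> u m W \<psi> w m'
  proof -
    have "count {#d - m * (1 - d\<^sup>2), d, - 2 * d#} \<kappa> = principal_multiplicity (f \<circ> \<phi>) (N \<circ> \<phi>) u \<kappa>"
      "count {#d - m' * (1 - d\<^sup>2), d, - 2 * d#} \<kappa> = principal_multiplicity (f \<circ> \<psi>) (N \<circ> \<psi>) w \<kappa>" for \<kappa>
      using that(3,6) unfolding rate_def by (metis (no_types, lifting) ext mult_1 scaleR_one)+
    moreover have "principal_multiplicity (f \<circ> \<phi>) (N \<circ> \<phi>) u \<kappa> = principal_multiplicity (f \<circ> \<psi>) (N \<circ> \<psi>) w \<kappa>" for \<kappa>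
      using const that unfolding constant_principal_curvatures_def by blast
    \<comment> \<open>The common entries \<open>d\<close> and \<open>- 2 * d\<close> cancel from the
      multisets, and 1 - d^2 is nonzero, so the rates agree.\<close>
    ultimately have "{#d - m * (1 - d\<^sup>2), d, - 2 * d#} = {#d - m' * (1 - d\<^sup>2), d, - 2 * d#}"
      by (intro multiset_eqI) metis
    then show ?thesis
      using d by simp
  qed
  obtain p where "p \<in> topspace M"
    using nonempty by blast
  then obtain V0 \<phi>0 u0 m where m: "(V0, \<phi>0) \<in> \<A>" "u0 \<in> V0" "rate V0 \<phi>0 u0 m"
    using ex_chart ex by blast
  have rate: "rate V \<phi> u m" if "(V, \<phi>) \<in> \<A>" "u \<in> V" for V \<phi> u
    using ex[OF that] unique[OF m that] by blast
  show ?thesis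
  proof (rule that[of m])
    show "has_principal_curvatures \<A> f (\<lambda>p. \<epsilon> *\<^sub>R N p)
      {#\<epsilon> * (d - m * (1 - d\<^sup>2)), \<epsilon> * d, \<epsilon> * (- 2 * d)#}" for \<epsilon>
      by (rule has_principal_curvaturesI) (use rate in \<open>simp add: rate_def\<close>)
  qed (use rate in \<open>simp_all add: rate_def\<close>)
qed

text \<open>The rate \<open>m\<close> decides: 0 gives a fixed normal direction in the xy-plane and
  the second model, while -1/d gives circles and the first.\<close>

lemma oblique_case:
  assumes const: "constant_principal_curvatures \<A> f N" and lt: "c\<^sup>2 + d\<^sup>2 < 1"
    and \<epsilon>: "\<epsilon> \<in> {1, - 1}" "\<epsilon> * d = \<bar>d\<bar>"
  shows "\<exists>\<Phi>\<in>sol_isometries.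
    (\<exists>r>0. open_part (\<Phi> ` f ` topspace M) (sol_M1 r) \<and>
       has_principal_curvatures \<A> f (\<lambda>p. \<epsilon> *\<^sub>R N p) {#coth r, tanh r, - 2 * tanh r#}) \<or>
    (\<exists>r\<ge>0. open_part (\<Phi> ` f ` topspace M) (sol_M2 r) \<and>
       has_principal_curvatures \<A> f (\<lambda>p. \<epsilon> *\<^sub>R N p) {#tanh r, tanh r, - 2 * tanh r#})"
proof -
  obtain V0 \<phi>0 u0 where V0: "(V0, \<phi>0) \<in> \<A>" "u0 \<in> V0"
    using nonempty ex_chart by blast
  have c: "c = 0"
    by (rule sol_patch.angle_E3_eq_0[OF patch[OF V0(1)] lt V0(2)])
  have d: "d\<^sup>2 < 1" "\<bar>d\<bar> < 1"
    using lt c by (auto simp: abs_square_less_1)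
  \<comment> \<open>Here \<rho> is the length of (a, b); in the chart lemmas the same letter is its
    square.\<close>
  define \<rho> where "\<rho> = sqrt (1 - d\<^sup>2)"
  have \<rho>: "\<rho> > 0" "\<rho>\<^sup>2 = 1 - d\<^sup>2"
    using d by (simp_all add: \<rho>_def)
  have ab: "(a p)\<^sup>2 + (b p)\<^sup>2 = \<rho>\<^sup>2" if "p \<in> topspace M" for p
    using ab_unit[OF that] c \<rho> by simp
  define r where "r = artanh \<bar>d\<bar>"
  have r: "tanh r = \<bar>d\<bar>" "sinh r = \<bar>d\<bar> / \<rho>"
    using d tanh_artanh_real[of "\<bar>d\<bar>"] sinh_artanh_real[of "\<bar>d\<bar>"] by (auto simp: r_def \<rho>_def)
  obtain m where rot: "\<And>V \<phi> u v. (V, \<phi>) \<in> \<A> \<Longrightarrow> u \<in> V \<Longrightarrow> sol_patch.\<alpha>' (f \<circ> \<phi>) (N \<circ> \<phi>) u v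
      = - m * b (\<phi> u) * sol_patch.\<theta> (f \<circ> \<phi>) (N \<circ> \<phi>) u v"
    "\<And>V \<phi> u v. (V, \<phi>) \<in> \<A> \<Longrightarrow> u \<in> V \<Longrightarrow> sol_patch.\<beta>' (f \<circ> \<phi>) (N \<circ> \<phi>) u v
      = m * a (\<phi> u) * sol_patch.\<theta> (f \<circ> \<phi>) (N \<circ> \<phi>) u v"
    and curv: "\<And>\<epsilon>. has_principal_curvatures \<A> f (\<lambda>p. \<epsilon> *\<^sub>R N p)
      {#\<epsilon> * (d - m * (1 - d\<^sup>2)), \<epsilon> * d, \<epsilon> * (- 2 * d)#}"
    using ex_rotation_rate[OF const d(1) c] by metis
  show ?thesis
  proof (cases "m = 0")
    case True
    have "((\<lambda>u. a (\<phi> u)) has_derivative (\<lambda>_. 0)) (at u)" "((\<lambda>u. b (\<phi> u)) has_derivative (\<lambda>_. 0)) (at u)"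
      if V: "(V, \<phi>) \<in> \<A>" "u \<in> V" for V \<phi> u
    proof -
      have "sol_patch.\<alpha>' (f \<circ> \<phi>) (N \<circ> \<phi>) u = (\<lambda>_. 0)" "sol_patch.\<beta>' (f \<circ> \<phi>) (N \<circ> \<phi>) u = (\<lambda>_. 0)"
        using rot[OF V] True by auto
      then show "((\<lambda>u. a (\<phi> u)) has_derivative (\<lambda>_. 0)) (at u)" "((\<lambda>u. b (\<phi> u)) has_derivative (\<lambda>_. 0)) (at u)"
        using sol_patch.\<alpha>_deriv[OF patch[OF V(1)] V(2)] sol_patch.\<beta>_deriv[OF patch[OF V(1)] V(2)]
        by (simp_all add: patch_\<alpha>[OF V(1)] patch_\<beta>[OF V(1)])
    qed
    then obtain a0 b0 where a0: "\<And>p. p \<in> topspace M \<Longrightarrow> a p = a0" and b0: "\<And>p. p \<in> topspace M \<Longrightarrow> b p = b0"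
      using constant_onE[of a] constant_onE[of b] by metis
    have ab0: "a0\<^sup>2 + b0\<^sup>2 = \<rho>\<^sup>2"
      using ab a0 b0 nonempty by (metis ex_in_conv)
    obtain k where k: "\<And>p. p \<in> topspace M \<Longrightarrow> a0 * f p $ 1 + b0 * f p $ 2 + d * exp (f p $ 4) = k"
    proof (rule constant_onE)
      fix V \<phi> u
      assume V: "(V, \<phi>) \<in> \<A>" "u \<in> V"
      show "((\<lambda>u. a0 * f (\<phi> u) $ 1 + b0 * f (\<phi> u) $ 2 + d * exp (f (\<phi> u) $ 4)) has_derivative (\<lambda>_. 0)) (at u)"
        using sol_patch.first_integral_flat[OF patch[OF V(1)] c V(2), of a0 b0]
          a0 b0 chart_in_topspace[OF V(1)] by (simp add: patch_\<alpha>[OF V(1)] patch_\<beta>[OF V(1)])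
    qed blast
    \<comment> \<open>This rotation takes (a0, b0) / \<rho> to -\<epsilon> times the y-direction.
      The first integral then reads y = e^t sinh r - \<epsilon> k / \<rho>, and \<open>q\<close>
      removes the constant.\<close>
    define C S where "C = - \<epsilon> * b0 / \<rho>" and "S = - \<epsilon> * a0 / \<rho>"
    have CS: "C\<^sup>2 + S\<^sup>2 = 1"
      using ab0 \<epsilon>(1) \<rho>(1) by (auto simp: C_def S_def power_divide power_mult_distrib add.commute simp flip: add_divide_distrib)
    define q :: "real ^ 4" where "q = vector [0, \<epsilon> * k / \<rho>, 0, 0]"
    define \<Phi> where "\<Phi> p = q + sol_motion_linear (q$4) C S 1 p" for p
    define P :: "real ^ 4 \<Rightarrow> real ^ 3" where "P p = vector [p$1, p$3, p$4]" for p
    have "\<Phi> \<in> sol_isometries"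
      unfolding \<Phi>_def[abs_def] by (intro sol_motion_in_sol_isometries CS) auto
    moreover have "open_part (\<Phi> ` f ` topspace M) (sol_M2 r)"
    proof (rule open_part_graph[OF hypersurface _ _ linear_sol_motion_linear \<Phi>_def])
      show "linear P"
        by (auto intro!: linearI simp: P_def vec3_eq_iff)
      show "inj_on P (sol_M2 r)"
        by (auto simp: inj_on_def P_def vec3_eq_iff vec4_eq_iff sol_M2_eq)
      show "\<Phi> (f p) \<in> sol_M2 r" if "p \<in> topspace M" for p
        using k[OF that, symmetric] \<rho>(1) unfolding sol_M2_eq r \<epsilon>(2)[symmetric]
        by (simp add: \<Phi>_def q_def C_def S_def field_simps)
      show "X = 0" if "p \<in> topspace M" "sol_metric (f p) (N p) X = 0"
        "P (sol_motion_linear (q$4) C S 1 X) = 0" for p X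
      proof -
        have X: "X$3 = 0" "X$4 = 0" "C * X$1 - S * X$2 = 0"
          using that(3) by (auto simp: P_def vec3_eq_iff q_def)
        have "a0 * X$1 + b0 * X$2 = 0"
          using that(2) X c unfolding metric_N[OF that(1)] a0[OF that(1)] b0[OF that(1)] by simp
        moreover have "b0 * X$1 - a0 * X$2 = 0"
          using X(3) \<epsilon>(1) \<rho>(1) by (auto simp: C_def S_def field_simps)
        ultimately have "\<rho>\<^sup>2 * X$1 = 0" "\<rho>\<^sup>2 * X$2 = 0"
          using ab0 by algebra+
        then show ?thesis
          using X \<rho>(1) by (simp add: vec4_eq_iff)
      qed
    qed
    moreover have "has_principal_curvatures \<A> f (\<lambda>p. \<epsilon> *\<^sub>R N p) {#tanh r, tanh r, - 2 * tanh r#}"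
      using curv[of \<epsilon>] True unfolding r \<epsilon>(2)[symmetric] by (simp add: mult.left_commute)
    moreover have "r \<ge> 0"
      using d by (simp add: r_def artanh_real_nonneg)
    ultimately show ?thesis by blast
  next
    case False
    have md: "m * d = - 1"
    proof (rule sol_patch.rotation_rate_eq[OF patch[OF V0(1)] d(1) c V0(2) False])
    qed (simp_all add: rot[OF V0(1)] patch_\<alpha>[OF V0(1)] patch_\<beta>[OF V0(1)])
    then have "d \<noteq> 0" by auto
    obtain x0 where x0: "\<And>p. p \<in> topspace M \<Longrightarrow> f p $ 1 + d / (1 - d\<^sup>2) * exp (f p $ 4) * a p = x0"
    proof (rule constant_onE)
      fix V \<phi> u
      assume V: "(V, \<phi>) \<in> \<A>" "u \<in> V"
      show "((\<lambda>u. f (\<phi> u) $ 1 + d / (1 - d\<^sup>2) * exp (f (\<phi> u) $ 4) * a (\<phi> u)) has_derivative (\<lambda>_. 0)) (at u)"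
        using sol_patch.first_integral_round(1)[OF patch[OF V(1)] d(1) c V(2) md]
          rot[OF V] by (simp add: patch_\<alpha>[OF V(1)] patch_\<beta>[OF V(1)])
    qed blast
    obtain y0 where y0: "\<And>p. p \<in> topspace M \<Longrightarrow> f p $ 2 + d / (1 - d\<^sup>2) * exp (f p $ 4) * b p = y0"
    proof (rule constant_onE)
      fix V \<phi> u
      assume V: "(V, \<phi>) \<in> \<A>" "u \<in> V"
      show "((\<lambda>u. f (\<phi> u) $ 2 + d / (1 - d\<^sup>2) * exp (f (\<phi> u) $ 4) * b (\<phi> u)) has_derivative (\<lambda>_. 0)) (at u)"
        using sol_patch.first_integral_round(2)[OF patch[OF V(1)] d(1) c V(2) md]
          rot[OF V] by (simp add: patch_\<alpha>[OF V(1)] patch_\<beta>[OF V(1)])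
    qed blast
    have "r > 0"
      using d \<open>d \<noteq> 0\<close> by (simp add: r_def artanh_real_pos)
    \<comment> \<open>The common centre (x0, y0) of the circles moves to the origin.\<close>
    define q :: "real ^ 4" where "q = vector [- x0, - y0, 0, 0]"
    define \<Phi> where "\<Phi> p = q + sol_motion_linear (q$4) 1 0 1 p" for p
    define P :: "real ^ 4 \<Rightarrow> real ^ 3" where "P p = vector [p$1, p$2, p$3]" for p
    have "\<Phi> \<in> sol_isometries"
      unfolding \<Phi>_def[abs_def] by (intro sol_motion_in_sol_isometries) auto
    moreover have "open_part (\<Phi> ` f ` topspace M) (sol_M1 r)"
    proof (rule open_part_graph[OF hypersurface _ _ linear_sol_motion_linear \<Phi>_def])
      show "linear P"
        by (auto intro!: linearI simp: P_def vec3_eq_iff)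
      \<comment> \<open>The coordinate t is recovered from x^2 + y^2, since sinh r is not 0.\<close>
      show "inj_on P (sol_M1 r)"
      proof (rule inj_onI)
        fix p p'
        assume p: "p \<in> sol_M1 r" "p' \<in> sol_M1 r" "P p = P p'"
        then have "(exp (p$4) * sinh r)\<^sup>2 = (exp (p'$4) * sinh r)\<^sup>2"
          by (simp add: sol_M1_eq[OF \<open>r > 0\<close>] P_def vec3_eq_iff)
        then have "p$4 = p'$4"
          using \<open>r > 0\<close> by (simp add: power_mult_distrib)
        then show "p = p'"
          using p(3) by (simp add: P_def vec3_eq_iff vec4_eq_iff)
      qed
      show "\<Phi> (f p) \<in> sol_M1 r" if "p \<in> topspace M" for p
      proof -
        have "\<Phi> (f p) $ 1 = - (d / \<rho>\<^sup>2 * exp (f p $ 4) * a p)" "\<Phi> (f p) $ 2 = - (d / \<rho>\<^sup>2 * exp (f p $ 4) * b p)"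
          using x0[OF that] y0[OF that] \<rho>(2) by (simp_all add: \<Phi>_def q_def)
        then have "(\<Phi> (f p) $ 1)\<^sup>2 + (\<Phi> (f p) $ 2)\<^sup>2 = (d / \<rho>\<^sup>2 * exp (f p $ 4))\<^sup>2 * ((a p)\<^sup>2 + (b p)\<^sup>2)"
          by (simp add: power_mult_distrib power_divide distrib_left)
        also have "\<dots> = (exp (f p $ 4) * sinh r)\<^sup>2"
          unfolding ab[OF that] r using \<rho>(1) by (simp add: power_mult_distrib power_divide field_simps)
        also have "f p $ 4 = \<Phi> (f p) $ 4"
          by (simp add: \<Phi>_def q_def)
        finally show ?thesis
          by (simp add: sol_M1_eq[OF \<open>r > 0\<close>])
      qed
      show "X = 0" if "p \<in> topspace M" "sol_metric (f p) (N p) X = 0"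
        "P (sol_motion_linear (q$4) 1 0 1 X) = 0" for p X
        using that(2,3) \<open>d \<noteq> 0\<close> unfolding metric_N[OF that(1)]
        by (auto simp: P_def vec3_eq_iff vec4_eq_iff q_def)
    qed
    moreover have "has_principal_curvatures \<A> f (\<lambda>p. \<epsilon> *\<^sub>R N p) {#coth r, tanh r, - 2 * tanh r#}"
    proof -
      \<comment> \<open>With m = -1/d the third curvature is 1/d, which after the choice of sign is
        1 / |d| = coth r.\<close>
      have "d * (d - m * (1 - d\<^sup>2)) = 1"
        using md by algebra
      then have "\<epsilon> * (d - m * (1 - d\<^sup>2)) = 1 / (\<epsilon> * d)"
        using \<epsilon>(1) \<open>d \<noteq> 0\<close> by (auto simp: field_simps)
      also have "\<dots> = coth r"
        unfolding \<epsilon>(2) r(1)[symmetric] by (simp add: coth_def tanh_def)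
      finally show ?thesis
        using curv[of \<epsilon>] unfolding r \<epsilon>(2)[symmetric] by (simp add: algebra_simps)
    qed
    ultimately show ?thesis
      using \<open>r > 0\<close> by blast
  qed
qed

end

theorem theorem1p1:
  fixes M :: "'m topology" and \<A> :: "(real ^ 3, 'm) atlas" and f N :: "'m \<Rightarrow> real ^ 4"
  assumes "sol_hypersurface M \<A> f N"
    and "connected_space M"
    and "constant_principal_curvatures \<A> f N"
    and "angle_function f N sol_E3 constant_on topspace M"
    and "angle_function f N sol_E4 constant_on topspace M"
  shows "\<exists>\<Phi>\<in>sol_isometries. \<exists>\<epsilon>\<in>{1, - 1}.
      (\<exists>r>0. open_part (\<Phi> ` f ` topspace M) (sol_M1 r) \<and>
         has_principal_curvatures \<A> f (\<lambda>p. \<epsilon> *\<^sub>R N p) {#coth r, tanh r, - 2 * tanh r#}) \<or>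
      (\<exists>r\<ge>0. open_part (\<Phi> ` f ` topspace M) (sol_M2 r) \<and>
         has_principal_curvatures \<A> f (\<lambda>p. \<epsilon> *\<^sub>R N p) {#tanh r, tanh r, - 2 * tanh r#}) \<or>
      (\<exists>r\<ge>0. open_part (\<Phi> ` f ` topspace M) (sol_M3 r) \<and>
         has_principal_curvatures \<A> f (\<lambda>p. \<epsilon> *\<^sub>R N p)
           {#tanh (2 * r), tanh (2 * r), - 2 * tanh (2 * r)#}) \<or>
      (open_part (\<Phi> ` f ` topspace M) sol_M4_0 \<and>
         has_principal_curvatures \<A> f (\<lambda>p. \<epsilon> *\<^sub>R N p) {#1, 1, - 2#})"
proof (cases "topspace M = {}")
  case True
  have "smooth_manifold M \<A>"
    using assms(1) by (simp add: sol_hypersurface_def)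
  then have "V = {}" if "(V, \<phi>) \<in> \<A>" for V \<phi>
    using that True unfolding smooth_manifold_def by blast
  then have "has_principal_curvatures \<A> f (\<lambda>p. \<epsilon> *\<^sub>R N p) {#1, 1, - 2#}" for \<epsilon>
    unfolding has_principal_curvatures_def by blast
  \<comment> \<open>For empty \<open>M\<close> the claims are vacuous; the identity, written as a
    trivial motion, and the last alternative serve.\<close>
  moreover have "(\<lambda>p. 0 + sol_motion_linear ((0 :: real ^ 4) $ 4) 1 0 1 p) \<in> sol_isometries"
    by (rule sol_motion_in_sol_isometries) auto
  moreover have "open_part {} sol_M4_0"
    by (simp add: open_part_def)
  ultimately show ?thesis
    using True by (metis image_empty insertI1)
next
  case False
  obtain c d where c: "\<And>p. p \<in> topspace M \<Longrightarrow> angle_function f N sol_E3 p = c"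
    and d: "\<And>p. p \<in> topspace M \<Longrightarrow> angle_function f N sol_E4 p = d"
    using assms(4,5) unfolding constant_on_def by metis
  interpret constant_angle_hypersurface M \<A> f N c d
    by unfold_locales (use assms False c d in auto)
  \<comment> \<open>N is oriented to make its E_4-component nonnegative, so that \<open>d\<close>
    becomes |d| in every list of curvatures.\<close>
  obtain \<epsilon> :: real where \<epsilon>: "\<epsilon> \<in> {1, - 1}" "\<epsilon> * d = \<bar>d\<bar>"
    by (cases "d \<ge> 0") (use that[of 1] that[of "- 1"] in auto)
  obtain p where "p \<in> topspace M"
    using False by blast
  then have "c\<^sup>2 + d\<^sup>2 \<le> 1"
    using ab_unit[of p] sum_power2_ge_zero[of "a p" "b p"] by linarith
  \<comment> \<open>Equality means that N lies in the plane of E_3 and E_4.\<close>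
  then consider "c\<^sup>2 + d\<^sup>2 = 1" | "c\<^sup>2 + d\<^sup>2 < 1" by linarith
  then show ?thesis
  proof cases
    case 1
    show ?thesis
      using horizontal_case[OF 1 \<epsilon>(2)] \<epsilon>(1) by blast
  next
    case 2
    show ?thesis
      using oblique_case[OF assms(3) 2 \<epsilon>] \<epsilon>(1) by blast
  qed
qed

end
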